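(* Let $\mathbf H_1,\dots,\mathbf H_p$ be Hermitian $d\times d$ matrices each with all eigenvalues integers, and with $\max_{i,j}|E^{(l)}_i-E^{(l)}_j|\le\Delta$ for every $l$, where $E^{(l)}_1,\dots,E^{(l)}_d$ are the eigenvalues of $\mathbf H_l$. Let $\mathbf M$ be Hermitian and $\mathcal S$ any dataset, and suppose $L(\cdot;\mathcal S)$ has finitely many critical points within one period. Then within one period $[0,2\pi)^p$, $L(\boldsymbol\theta;\mathcal S)$ has at most $(4\Delta p)^p$ local minima.
   Context: A $p$-parameter QNN is given by Hermitian $\mathbf H_1,\dots,\mathbf H_p$ and Hermitian observable $\mathbf M$; $\mathbf U(\boldsymbol\theta)=e^{-i\theta_p\mathbf H_p}\cdots e^{-i\theta_1\mathbf H_1}$. A dataset is a finite set $\mathcal S=\{(\boldsymbol\rho_i,y_i)\}_{i=1}^m$ of density matrices (PSD, trace 1) and real labels, with loss $L(\boldsymbol\theta;\mathcal S)=\frac1m\sum_i\big(\operatorname{tr}(\mathbf U(\boldsymbol\theta)\boldsymbol\rho_i\mathbf U(\boldsymbol\theta)^\dagger\mathbf M)-y_i\big)^2$. With integer spectra, $L$ is $2\pi$-periodic in each coordinate. *)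

theory Defs
  imports "HOL-Analysis.Analysis" "Jordan_Normal_Form.Schur_Decomposition"
begin

definition hermitian_mat :: "complex mat \<Rightarrow> bool" where
  "hermitian_mat A \<longleftrightarrow> dim_row A = dim_col A \<and> mat_adjoint A = A"

definition tr :: "complex mat \<Rightarrow> complex" where
  "tr A = (\<Sum>i<dim_row A. A $$ (i, i))"

definition density_mat :: "nat \<Rightarrow> complex mat \<Rightarrow> bool" where
  "density_mat d \<rho> \<longleftrightarrow> \<rho> \<in> carrier_mat d d \<and> hermitian_mat \<rho> \<and>
     (\<forall>v \<in> carrier_vec d. 0 \<le> Re (conjugate v \<bullet> (\<rho> *\<^sub>v v))) \<and> tr \<rho> = 1"

definition mat_exp :: "complex mat \<Rightarrow> complex mat" where
  "mat_exp A = mat (dim_row A) (dim_row A)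
     (\<lambda>(i, j). (\<Sum>k. (A ^\<^sub>m k) $$ (i, j) / of_nat (fact k)))"

fun qnn_U :: "nat \<Rightarrow> (nat \<Rightarrow> complex mat) \<Rightarrow> nat \<Rightarrow> (nat \<Rightarrow> real) \<Rightarrow> complex mat" where
  "qnn_U d H 0 \<theta> = 1\<^sub>m d"
| "qnn_U d H (Suc k) \<theta> =
     mat_exp ((- \<i> * complex_of_real (\<theta> k)) \<cdot>\<^sub>m H k) * qnn_U d H k \<theta>"

definition qnn_loss ::
  "nat \<Rightarrow> (nat \<Rightarrow> complex mat) \<Rightarrow> complex mat \<Rightarrow> nat \<Rightarrow> nat \<Rightarrow> (nat \<Rightarrow> complex mat)
    \<Rightarrow> (nat \<Rightarrow> real) \<Rightarrow> (nat \<Rightarrow> real) \<Rightarrow> real" where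
  "qnn_loss d H M p m \<rho> y \<theta> =
     (1 / real m) * (\<Sum>i<m. (Re (tr (qnn_U d H p \<theta> * \<rho> i * mat_adjoint (qnn_U d H p \<theta>) * M))
                              - y i)\<^sup>2)"

text \<open>Parameter vectors in R^p are represented as functions nat => real vanishing from p on.\<close>
definition param_space :: "nat \<Rightarrow> (nat \<Rightarrow> real) set" where
  "param_space p = {\<theta>. \<forall>i\<ge>p. \<theta> i = 0}"

definition period_box :: "nat \<Rightarrow> (nat \<Rightarrow> real) set" where
  "period_box p = {\<theta> \<in> param_space p. \<forall>i<p. 0 \<le> \<theta> i \<and> \<theta> i < 2 * pi}"

definition critical_point :: "nat \<Rightarrow> ((nat \<Rightarrow> real) \<Rightarrow> real) \<Rightarrow> (nat \<Rightarrow> real) \<Rightarrow> bool" where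
  "critical_point p L \<theta> \<longleftrightarrow> \<theta> \<in> param_space p \<and>
     (\<forall>l<p. ((\<lambda>t. L (\<theta>(l := t))) has_real_derivative 0) (at (\<theta> l)))"

definition local_min :: "nat \<Rightarrow> ((nat \<Rightarrow> real) \<Rightarrow> real) \<Rightarrow> (nat \<Rightarrow> real) \<Rightarrow> bool" where
  "local_min p L \<theta> \<longleftrightarrow> \<theta> \<in> param_space p \<and>
     (\<exists>\<epsilon>>0. \<forall>\<theta>' \<in> param_space p. (\<forall>i<p. \<bar>\<theta>' i - \<theta> i\<bar> < \<epsilon>) \<longrightarrow> L \<theta> \<le> L \<theta>')"

end

theory Submission
  imports Defs "Jordan_Normal_Form.Spectral_Radius" "Jordan_Normal_Form.Jordan_Normal_Form_Existence"
begin

text \<open>By the spectral theorem the loss \<open>L\<close> is a trigonometric polynomial of degree at most \<open>2 \<Delta>\<close> in each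
  coordinate, hence of total degree at most \<open>n = 2 \<Delta> p\<close>. Replace \<open>L\<close> by
  \<open>L + (t / n) \<Sum>\<^sub>i sin (n \<theta>\<^sub>i)\<close> with small \<open>t > 0\<close>: isolated local minima persist, and the critical points
  solve \<open>\<partial>\<^sub>i L + t cos (n \<theta>\<^sub>i) = 0\<close>. Modulo these \<open>p\<close> equations every trigonometric polynomial of bounded
  degree is, for all but finitely many \<open>t\<close>, congruent to a combination of the \<open>(2 n)\<^sup>p\<close> characters with frequencies
  in \<open>(-n, n]\<close>, so there are at most \<open>(2 n)\<^sup>p = (4 \<Delta> p)\<^sup>p\<close> solutions on the torus.\<close>

unbundle no vec_syntax

section \<open>Trigonometric polynomials on the torus\<close>

text \<open>The gradient system of \<open>L\<close> itself resists a count of Bezout type: its zeros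
  may be degenerate and its top-degree parts may vanish together, so division by them has no degree
  control. The perturbation supplies that control. In the variables z_j = exp(i \<theta>_j) a
  character is a Laurent monomial z^a, and cos(n \<theta>_i) is (z_i^n + z_i^(-n)) / 2. These
  divisors involve separate variables, and the quotients have degree n less than the dividend. The
  partial derivatives of \<open>L\<close> have total degree at most n, so a quotient times such a
  derivative meets the original degree bound again. The reduction thus closes up in a
  finite-dimensional space and can fail only if -t is an eigenvalue of one fixed matrix. This is why
  the perturbing frequency is the total degree of \<open>L\<close>. Finiteness of the critical
  points makes the local minima finite in number and strict on small spheres, so that each can be
  replaced by a nearby critical point of the perturbed loss.\<close>

definition torus_char :: "nat \<Rightarrow> (nat \<Rightarrow> int) \<Rightarrow> (nat \<Rightarrow> real) \<Rightarrow> complex" where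
  "torus_char p a \<theta> = cis (\<Sum>j<p. of_int (a j) * \<theta> j)"

text \<open>The linear span of the characters with frequencies in \<open>A\<close>, generated
  inductively: closure under products, conjugates and derivatives is a structural induction that
  tracks the frequency set, whatever its size. Explicit coefficients return in
  \<open>trig_poly_coeffs\<close>.\<close>

inductive_set trig_poly :: "nat \<Rightarrow> (nat \<Rightarrow> int) set \<Rightarrow> ((nat \<Rightarrow> real) \<Rightarrow> complex) set"
  for p A where
  zero: "(\<lambda>_. 0) \<in> trig_poly p A"
| add_char: "f \<in> trig_poly p A \<Longrightarrow> a \<in> A \<Longrightarrow> (\<lambda>\<theta>. f \<theta> + c * torus_char p a \<theta>) \<in> trig_poly p A"

lemma torus_char_mult:
  "torus_char p a \<theta> * torus_char p b \<theta> = torus_char p (\<lambda>j. a j + b j) \<theta>"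
  by (simp add: torus_char_def cis_mult sum.distrib ring_distribs)

lemma torus_char_cnj: "cnj (torus_char p a \<theta>) = torus_char p (\<lambda>j. - a j) \<theta>"
  by (simp add: torus_char_def cis_cnj sum_negf)

lemma torus_char_zero [simp]: "torus_char p (\<lambda>_. 0) \<theta> = 1"
  by (simp add: torus_char_def)

lemma torus_char_unit:
  assumes "l < p"
  shows "torus_char p (\<lambda>j. if j = l then k else 0) \<theta> = cis (of_int k * \<theta> l)"
proof -
  have "(\<Sum>j<p. of_int (if j = l then k else 0) * \<theta> j) = (\<Sum>j<p. if j = l then of_int k * \<theta> l else 0)"
    by (rule sum.cong) auto
  then show ?thesis using assms by (simp add: torus_char_def)
qed

lemma torus_char_update:
  assumes "l < p"
  shows "torus_char p (a(l := k)) \<theta> = torus_char p a \<theta> * cis (of_int (k - a l) * \<theta> l)"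
proof -
  have "a(l := k) = (\<lambda>j. a j + (if j = l then k - a l else 0))" by auto
  then show ?thesis
    using torus_char_mult[of p a \<theta> "\<lambda>j. if j = l then k - a l else 0"]
    by (simp add: torus_char_unit[OF assms])
qed

lemma cis_mult_of_int_cong:
  assumes "cis x = cis y"
  shows "cis (of_int k * x) = cis (of_int k * y)"
proof -
  have nat: "cis (of_nat n * x) = cis (of_nat n * y)" for n :: nat
    by (simp only: Complex.DeMoivre[symmetric] assms)
  show ?thesis
  proof (cases "k \<ge> 0")
    case True
    then show ?thesis using nat[of "nat k"] by simp
  next
    case False
    then have "cis (- (of_int k * x)) = cis (- (of_int k * y))"
      using nat[of "nat (-k)"] by simp
    then show ?thesis by (metis cis_cnj complex_cnj_cancel_iff)
  qed
qed

text \<open>Integrality of the frequencies enters here: a character factors through the numbers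
  \<open>cis (\<theta> j)\<close>, so everything built from characters lives on the torus.\<close>

lemma torus_char_cong:
  assumes "\<And>j. j < p \<Longrightarrow> cis (\<theta> j) = cis (\<theta>' j)"
  shows "torus_char p a \<theta> = torus_char p a \<theta>'"
proof -
  have "torus_char p a \<theta> = (\<Prod>j<p. cis (of_int (a j) * \<theta> j))" for \<theta>
  proof -
    have "cis (\<Sum>j<q. f j) = (\<Prod>j<q. cis (f j))" for q :: nat and f
      by (induction q) (simp_all add: cis_mult[symmetric])
    then show ?thesis by (simp add: torus_char_def)
  qed
  then show ?thesis
    using cis_mult_of_int_cong[OF assms] by (auto intro!: prod.cong)
qed

lemma trig_poly_mono:
  assumes "f \<in> trig_poly p A" "A \<subseteq> B"
  shows "f \<in> trig_poly p B"
  using assms by (induction) (auto intro: trig_poly.intros)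

lemma trig_poly_scaled_char: "a \<in> A \<Longrightarrow> (\<lambda>\<theta>. c * torus_char p a \<theta>) \<in> trig_poly p A"
  using trig_poly.add_char[OF trig_poly.zero, of a A c p] by simp

lemma trig_poly_char: "a \<in> A \<Longrightarrow> torus_char p a \<in> trig_poly p A"
  using trig_poly_scaled_char[of a A 1 p] by simp

lemma trig_poly_add:
  assumes "f \<in> trig_poly p A" "g \<in> trig_poly p A"
  shows "(\<lambda>\<theta>. f \<theta> + g \<theta>) \<in> trig_poly p A"
  using assms(2)
proof induction
  case zero
  then show ?case using assms(1) by simp
next
  case (add_char g a c)
  then show ?case using trig_poly.add_char[of "\<lambda>\<theta>. f \<theta> + g \<theta>" p A a c] by (simp add: add.assoc)
qed

lemma trig_poly_mult:
  assumes "f \<in> trig_poly p A" "g \<in> trig_poly p B"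
    and AB: "\<And>a b. a \<in> A \<Longrightarrow> b \<in> B \<Longrightarrow> (\<lambda>j. a j + b j) \<in> C"
  shows "(\<lambda>\<theta>. f \<theta> * g \<theta>) \<in> trig_poly p C"
  using assms(1)
proof induction
  case zero
  then show ?case by (simp add: trig_poly.zero)
next
  case (add_char f a c)
  have "(\<lambda>\<theta>. c * torus_char p a \<theta> * g \<theta>) \<in> trig_poly p C"
    using assms(2)
  proof induction
    case zero
    then show ?case by (simp add: trig_poly.zero)
  next
    case (add_char g b e)
    have "(\<lambda>\<theta>. c * torus_char p a \<theta> * g \<theta> + (c * e) * torus_char p (\<lambda>j. a j + b j) \<theta>) \<in> trig_poly p C"
      using add_char AB \<open>a \<in> A\<close> by (intro trig_poly.add_char) auto
    then show ?case by (simp add: torus_char_mult[symmetric] algebra_simps)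
  qed
  from trig_poly_add[OF add_char.IH this] show ?case by (simp add: algebra_simps)
qed

lemma trig_poly_scale:
  assumes "f \<in> trig_poly p A"
  shows "(\<lambda>\<theta>. c * f \<theta>) \<in> trig_poly p A"
  using assms
proof induction
  case zero
  then show ?case by (simp add: trig_poly.zero)
next
  case (add_char f a e)
  then show ?case using trig_poly.add_char[of "\<lambda>\<theta>. c * f \<theta>" p A a "c * e"] by (simp add: algebra_simps)
qed

lemma trig_poly_sum:
  assumes "\<And>i. i \<in> I \<Longrightarrow> f i \<in> trig_poly p A"
  shows "(\<lambda>\<theta>. \<Sum>i\<in>I. f i \<theta>) \<in> trig_poly p A"
  using assms by (induction I rule: infinite_finite_induct) (auto intro: trig_poly.zero trig_poly_add)

lemma trig_poly_cnj:
  assumes "f \<in> trig_poly p A" "\<And>a. a \<in> A \<Longrightarrow> (\<lambda>j. - a j) \<in> B"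
  shows "(\<lambda>\<theta>. cnj (f \<theta>)) \<in> trig_poly p B"
  using assms(1)
proof induction
  case zero
  then show ?case by (simp add: trig_poly.zero)
next
  case (add_char f a c)
  then show ?case using trig_poly.add_char[OF add_char.IH assms(2)[OF \<open>a \<in> A\<close>], of "cnj c"]
    by (simp add: torus_char_cnj)
qed

lemma trig_poly_cong:
  assumes "f \<in> trig_poly p A" "\<And>j. j < p \<Longrightarrow> cis (\<theta> j) = cis (\<theta>' j)"
  shows "f \<theta> = f \<theta>'"
  using assms(1) by induction (auto simp: torus_char_cong[OF assms(2)])

lemma trig_poly_coeffs:
  assumes "f \<in> trig_poly p A" "finite A"
  shows "\<exists>c. \<forall>\<theta>. f \<theta> = (\<Sum>a\<in>A. c a * torus_char p a \<theta>)"
  using assms(1)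
proof induction
  case zero
  show ?case by (rule exI[of _ "\<lambda>_. 0"]) simp
next
  case (add_char f a e)
  then obtain c where c: "\<And>\<theta>. f \<theta> = (\<Sum>a\<in>A. c a * torus_char p a \<theta>)" by blast
  have "f \<theta> + e * torus_char p a \<theta> = (\<Sum>b\<in>A. (c(a := c a + e)) b * torus_char p b \<theta>)" for \<theta>
    using assms(2) \<open>a \<in> A\<close> by (simp add: c sum.remove[of A a] algebra_simps)
  then show ?case by blast
qed

text \<open>Differentiation multiplies a character by i times its frequency, so the gradient
  inherits the degree bound of the function.\<close>

lemma trig_poly_partial_deriv:
  assumes "f \<in> trig_poly p A" "l < p"
  shows "\<exists>f' \<in> trig_poly p A. \<forall>\<theta>. ((\<lambda>t. f (\<theta>(l := t))) has_vector_derivative f' \<theta>) (at (\<theta> l))"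
  using assms(1)
proof induction
  case zero
  show ?case by (rule bexI[OF _ trig_poly.zero]) simp
next
  case (add_char f a c)
  then obtain f' where f': "f' \<in> trig_poly p A"
    and der: "\<And>\<theta>. ((\<lambda>t. f (\<theta>(l := t))) has_vector_derivative f' \<theta>) (at (\<theta> l))" by blast
  have torus_char_der: "((\<lambda>t. torus_char p a (\<theta>(l := t))) has_vector_derivative (\<i> * of_int (a l)) * torus_char p a \<theta>) (at (\<theta> l))" for \<theta>
  proof -
    define s where "s = (\<Sum>j\<in>{..<p} - {l}. of_int (a j) * \<theta> j)"
    have sum: "(\<Sum>j<p. of_int (a j) * (\<theta>(l := t)) j) = of_int (a l) * t + s" for t
    proof -
      have "(\<Sum>j\<in>{..<p} - {l}. of_int (a j) * (\<theta>(l := t)) j) = s"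
        unfolding s_def by (rule sum.cong) auto
      then show ?thesis using assms(2) by (simp add: sum.remove[of "{..<p}" l])
    qed
    have E: "torus_char p a (\<theta>(l := t)) = cis (of_int (a l) * t + s)" for t
      unfolding torus_char_def sum ..
    have E0: "torus_char p a \<theta> = cis (of_int (a l) * \<theta> l + s)" using E[of "\<theta> l"] by simp
    have "((\<lambda>z. exp (\<i> * (of_int (a l) * z + of_real s))) has_field_derivative
        \<i> * of_int (a l) * exp (\<i> * (of_int (a l) * of_real (\<theta> l) + of_real s))) (at (of_real (\<theta> l)))"
      by (auto intro!: derivative_eq_intros)
    from has_vector_derivative_real_field[OF this] show ?thesis
      unfolding E E0 cis_conv_exp by simp
  qed
  have "((\<lambda>t. f (\<theta>(l := t)) + c * torus_char p a (\<theta>(l := t))) has_vector_derivative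
     f' \<theta> + (c * (\<i> * of_int (a l))) * torus_char p a \<theta>) (at (\<theta> l))" for \<theta>
    unfolding mult.assoc[of c]
    by (intro has_vector_derivative_add has_vector_derivative_mult_right der torus_char_der)
  then show ?case
    by (intro bexI[OF _ trig_poly.add_char[OF f' \<open>a \<in> A\<close>, of "c * (\<i> * of_int (a l))"]] allI)
qed

lemma continuous_on_trig_poly:
  assumes "f \<in> trig_poly p A"
  shows "continuous_on UNIV f"
  using assms
proof induction
  case zero
  show ?case by simp
next
  case (add_char f a c)
  have "continuous_on UNIV (torus_char p a)"
    unfolding torus_char_def cis_conv_exp by (intro continuous_intros continuous_on_product_coordinates)
  with add_char show ?case by (intro continuous_intros)
qed

section \<open>Linear algebra over finite index sets\<close>

text \<open>Padding the system with zero rows gives a square matrix; a zero row makes its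
  determinant vanish, whence a kernel vector. The vector will serve as a functional on point values
  that annihilates a prescribed set of characters.\<close>

lemma kernel_of_more_unknowns:
  fixes a :: "'q \<Rightarrow> 'r \<Rightarrow> 'a::field"
  assumes "finite Q" "finite R" "card R < card Q"
  shows "\<exists>c. (\<exists>q\<in>Q. c q \<noteq> 0) \<and> (\<forall>r\<in>R. (\<Sum>q\<in>Q. c q * a q r) = 0)"
proof -
  obtain u where u: "bij_betw u {..<card Q} Q"
    using assms(1) bij_betw_from_nat_into_finite by blast
  obtain w where w: "bij_betw w {..<card R} R"
    using assms(2) bij_betw_from_nat_into_finite by blast
  define n where "n = card Q"
  define X where "X = mat n n (\<lambda>(i, j). if i < card R then a (u j) (w i) else 0)"
  have X: "X \<in> carrier_mat n n" by (simp add: X_def)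
  have "row X (card R) = 0\<^sub>v n"
    using assms(3) by (intro eq_vecI) (auto simp: X_def n_def)
  then have "X\<^sup>T *\<^sub>v unit_vec n (card R) = 0\<^sub>v n"
    using X assms(3) by (intro eq_vecI) (auto simp: X_def n_def)
  moreover have "unit_vec n (card R) \<noteq> (0\<^sub>v n :: 'a vec)"
    using assms(3) by (simp add: n_def)
  ultimately have "\<exists>v. v \<in> carrier_vec n \<and> v \<noteq> 0\<^sub>v n \<and> X\<^sup>T *\<^sub>v v = 0\<^sub>v n"
    by (intro exI[of _ "unit_vec n (card R)"]) simp
  then have "det X\<^sup>T = 0"
    using det_0_iff_vec_prod_zero_field[of "X\<^sup>T" n] X by simp
  then have "det X = 0" using det_transpose[OF X] by simp
  then obtain v where v: "v \<in> carrier_vec n" "v \<noteq> 0\<^sub>v n" "X *\<^sub>v v = 0\<^sub>v n"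
    by (subst (asm) det_0_iff_vec_prod_zero_field) (use X in auto)
  define c where "c q = v $ (inv_into {..<n} u q)" for q
  have cu: "c (u j) = v $ j" if "j < n" for j
    using that u bij_betw_inv_into_left[OF u] by (simp add: c_def n_def)
  from v obtain j where j: "j < n" "v $ j \<noteq> 0"
    by (metis carrier_vecD eq_vecI index_zero_vec(1) index_zero_vec(2))
  then have "u j \<in> Q" "c (u j) \<noteq> 0"
    using cu[OF j(1)] bij_betwE[OF u] by (auto simp: n_def)
  then have "\<exists>q\<in>Q. c q \<noteq> 0" by blast
  moreover have "(\<Sum>q\<in>Q. c q * a q r) = 0" if "r \<in> R" for r
  proof -
    have "r \<in> w ` {..<card R}" using w that by (simp add: bij_betw_def)
    then obtain i where i: "i < card R" "r = w i" by auto
    have "(\<Sum>q\<in>Q. c q * a q r) = (\<Sum>j<n. c (u j) * a (u j) r)"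
      using sum.reindex_bij_betw[OF u, of "\<lambda>q. c q * a q r"] by (simp add: n_def)
    also have "\<dots> = (\<Sum>j<n. v $ j * a (u j) (w i))"
      using cu i by (intro sum.cong) auto
    also have "\<dots> = (X *\<^sub>v v) $ i"
      using i assms(3) v(1) by (simp add: X_def n_def scalar_prod_def lessThan_atLeast0 mult.commute)
    also have "\<dots> = 0" using v i assms(3) by (simp add: n_def)
    finally show ?thesis .
  qed
  ultimately show ?thesis by blast
qed

text \<open>Rows and columns will be indexed by frequencies; an enumeration of \<open>I\<close>
  transports the question to an ordinary matrix and its finite spectrum.\<close>

lemma finite_eigenvalues_indexed:
  fixes A :: "'i \<Rightarrow> 'i \<Rightarrow> 'a::field"
  assumes "finite I"
  shows "finite {t. \<exists>x. (\<exists>i\<in>I. x i \<noteq> 0) \<and> (\<forall>i\<in>I. (\<Sum>j\<in>I. A i j * x j) = t * x i)}"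
proof -
  obtain u where u: "bij_betw u {..<card I} I"
    using assms bij_betw_from_nat_into_finite by blast
  define n where "n = card I"
  define X where "X = mat n n (\<lambda>(i, j). A (u i) (u j))"
  have X: "X \<in> carrier_mat n n" by (simp add: X_def)
  have "eigenvalue X t" if x: "\<exists>i\<in>I. x i \<noteq> 0" "\<forall>i\<in>I. (\<Sum>j\<in>I. A i j * x j) = t * x i" for t x
  proof -
    define v where "v = vec n (\<lambda>j. x (u j))"
    have "v \<in> carrier_vec n" by (simp add: v_def)
    moreover have "v \<noteq> 0\<^sub>v n"
    proof -
      have "I = u ` {..<n}" using u by (simp add: bij_betw_def n_def)
      then obtain i where "i < n" "x (u i) \<noteq> 0" using x(1) by auto
      then have "v $ i \<noteq> 0\<^sub>v n $ i" by (simp add: v_def)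
      then show ?thesis by auto
    qed
    moreover have "X *\<^sub>v v = t \<cdot>\<^sub>v v"
    proof (rule eq_vecI)
      fix i assume "i < dim_vec (t \<cdot>\<^sub>v v)"
      then have i: "i < n" by (simp add: v_def)
      then have ui: "u i \<in> I" using u by (auto simp: n_def bij_betw_def)
      have "(X *\<^sub>v v) $ i = (\<Sum>j<n. A (u i) (u j) * x (u j))"
        using i by (simp add: X_def v_def scalar_prod_def lessThan_atLeast0)
      also have "\<dots> = (\<Sum>j\<in>I. A (u i) j * x j)"
        using sum.reindex_bij_betw[OF u, of "\<lambda>j. A (u i) j * x j"] by (simp add: n_def)
      finally show "(X *\<^sub>v v) $ i = (t \<cdot>\<^sub>v v) $ i" using x(2) ui i by (simp add: v_def)
    qed (simp add: X_def v_def)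
    ultimately show ?thesis unfolding eigenvalue_def eigenvector_def using X by auto
  qed
  then have "{t. \<exists>x. (\<exists>i\<in>I. x i \<noteq> 0) \<and> (\<forall>i\<in>I. (\<Sum>j\<in>I. A i j * x j) = t * x i)} \<subseteq> spectrum X"
    by (auto simp: spectrum_def)
  then show ?thesis using card_finite_spectrum(1)[OF X] finite_subset by blast
qed

section \<open>Counting common zeros\<close>

text \<open>Bounds the total degree of a Laurent polynomial. The radius is an integer so that the
  degree bound \<open>N - int n\<close> of a quotient may become negative; the ball is then empty
  and the quotient zero.\<close>

definition l1_ball :: "nat \<Rightarrow> int \<Rightarrow> (nat \<Rightarrow> int) set" where
  "l1_ball p N = {a. (\<forall>j\<ge>p. a j = 0) \<and> (\<Sum>j<p. \<bar>a j\<bar>) \<le> N}"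

text \<open>A monomial basis modulo the polynomials z_i^n + z_i^(-n), of dimension 2n per variable.
  The window is half open because the frequencies n and -n agree up to sign modulo the
  relation.\<close>

definition reduced_freqs :: "nat \<Rightarrow> nat \<Rightarrow> (nat \<Rightarrow> int) set" where
  "reduced_freqs p n = {a. (\<forall>j\<ge>p. a j = 0) \<and> (\<forall>j<p. - int n < a j \<and> a j \<le> int n)}"

lemma finite_l1_ball: "finite (l1_ball p N)"
proof (rule finite_subset)
  show "l1_ball p N \<subseteq> {a. \<forall>j. (j \<in> {..<p} \<longrightarrow> a j \<in> {-N..N}) \<and> (j \<notin> {..<p} \<longrightarrow> a j = 0)}"
  proof
    fix a assume a: "a \<in> l1_ball p N"
    have "\<bar>a j\<bar> \<le> N" if "j < p" for j
    proof -
      have "\<bar>a j\<bar> \<le> (\<Sum>j<p. \<bar>a j\<bar>)" using that by (intro member_le_sum) auto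
      then show ?thesis using a by (simp add: l1_ball_def)
    qed
    then have "a j \<in> {-N..N}" if "j < p" for j using that by (force simp: abs_le_iff)
    then show "a \<in> {a. \<forall>j. (j \<in> {..<p} \<longrightarrow> a j \<in> {-N..N}) \<and> (j \<notin> {..<p} \<longrightarrow> a j = 0)}"
      using a by (auto simp: l1_ball_def)
  qed
  show "finite {a. \<forall>j. (j \<in> {..<p} \<longrightarrow> a j \<in> {-N..N}) \<and> (j \<notin> {..<p} \<longrightarrow> a j = 0)}"
    by (rule finite_set_of_finite_funs) auto
qed

lemma reduced_freqs_finite_card:
  "finite (reduced_freqs p n) \<and> card (reduced_freqs p n) \<le> (2 * n) ^ p"
proof -
  define B where "B = PiE {..<p} (\<lambda>_. {- int n<..int n})"
  have fin: "finite B" unfolding B_def by (intro finite_PiE) auto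
  have "reduced_freqs p n \<subseteq> (\<lambda>a j. if j < p then a j else 0) ` B"
  proof
    fix a assume a: "a \<in> reduced_freqs p n"
    have "a = (\<lambda>j. if j < p then restrict a {..<p} j else 0)"
      using a by (auto simp: reduced_freqs_def)
    moreover have "restrict a {..<p} \<in> B" using a by (auto simp: reduced_freqs_def B_def)
    ultimately show "a \<in> (\<lambda>a j. if j < p then a j else 0) ` B" by (rule image_eqI)
  qed
  then have "finite (reduced_freqs p n)" "card (reduced_freqs p n) \<le> card B"
    using fin by (auto intro: finite_subset surj_card_le)
  moreover have "card B = (2 * n) ^ p" unfolding B_def by (simp add: card_PiE nat_mult_distrib power_mult_distrib)
  ultimately show ?thesis by simp
qed

lemma l1_ball_add:
  assumes "a \<in> l1_ball p M" "b \<in> l1_ball p N"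
  shows "(\<lambda>j. a j + b j) \<in> l1_ball p (M + N)"
proof -
  have "(\<Sum>j<p. \<bar>a j + b j\<bar>) \<le> (\<Sum>j<p. \<bar>a j\<bar> + \<bar>b j\<bar>)" by (intro sum_mono) simp
  also have "\<dots> \<le> M + N" using assms by (simp add: l1_ball_def sum.distrib)
  finally show ?thesis using assms by (simp add: l1_ball_def)
qed

lemma sum_fun_upd:
  fixes F :: "'b \<Rightarrow> 'c::ab_group_add" and i p :: nat
  assumes "i < p"
  shows "(\<Sum>j<p. F ((a(i := k)) j)) = (\<Sum>j<p. F (a j)) - F (a i) + F k"
proof -
  have "(\<Sum>j\<in>{..<p} - {i}. F ((a(i := k)) j)) = (\<Sum>j\<in>{..<p} - {i}. F (a j))"
    by (rule sum.cong) auto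
  then show ?thesis using assms by (simp add: sum.remove[of "{..<p}" i] fun_upd_same del: fun_upd_apply)
qed

text \<open>The rewriting rule of the division: with x = s \<theta>_i it turns z^a + z^(a - 2 s e_i)
  into 2 cos(s \<theta>_i) z^(a - s e_i).\<close>

lemma one_add_cis_double: "1 + cis (- 2 * x) = 2 * of_real (cos x) * cis (- x)"
  by (simp add: complex_eq_iff cos_double_cos sin_double power2_eq_square)

text \<open>Multivariate division with remainder by the \<open>p\<close> polynomials \<open>cos (n \<theta>\<^sub>i)\<close>, which are up to
  a factor 2 the Laurent polynomials \<open>z\<^sub>i\<^sup>n + 1 / z\<^sub>i\<^sup>n\<close>. The degree bound on the quotients \<open>h\<close> is what
  survives a perturbation of the divisors by terms of degree at most \<open>n\<close>.\<close>
lemma torus_char_division: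
  assumes n: "0 < n" and "a \<in> l1_ball p N"
  shows "\<exists>r h. r \<in> trig_poly p (reduced_freqs p n) \<and>
    (\<forall>i<p. h i \<in> trig_poly p (l1_ball p (N - int n))) \<and>
    (\<forall>\<theta>. torus_char p a \<theta> = r \<theta> + (\<Sum>i<p. of_real (cos (real n * \<theta> i)) * h i \<theta>))"
  using assms(2)
\<comment> \<open>The integer window (-n, n] is symmetric about 1/2, so the measure is twice the
  distance to 1/2. With \<open>\<bar>a j\<bar>\<close> alone the rewriting of -n to n would not
  decrease.\<close>
proof (induction "nat (\<Sum>j<p. \<bar>2 * a j - 1\<bar>)" arbitrary: a rule: less_induct)
  case less
  show ?case
  proof (cases "\<forall>j<p. - int n < a j \<and> a j \<le> int n")
    case True
    then have "a \<in> reduced_freqs p n" using less.prems by (simp add: reduced_freqs_def l1_ball_def)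
    then show ?thesis
      by (intro exI[of _ "torus_char p a"] exI[of _ "\<lambda>_ _. 0"]) (simp add: trig_poly.zero trig_poly_char)
  next
    case False
    then obtain i where i: "i < p" "a i \<le> - int n \<or> int n < a i" by force
    \<comment> \<open>The rewriting moves coordinate i by 2n, and \<open>b\<close> is the halfway
      point. Its coordinate is smaller by exactly n in absolute value, which is the degree bound of
      the quotient.\<close>
    define s where "s = (if int n < a i then int n else - int n)"
    define b where "b = a(i := a i - s)"
    define a' where "a' = a(i := a i - 2 * s)"
    have abs1: "\<bar>2 * (a i - 2 * s) - 1\<bar> < \<bar>2 * a i - 1\<bar>" and abs2: "\<bar>a i - 2 * s\<bar> \<le> \<bar>a i\<bar>"
      and abs3: "\<bar>a i - s\<bar> = \<bar>a i\<bar> - int n"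
      using n i(2) by (auto simp: s_def)
    have a': "a' \<in> l1_ball p N"
      using less.prems abs2 i(1) unfolding a'_def l1_ball_def
      by (auto simp: sum_fun_upd[where F = abs] simp del: fun_upd_apply) auto
    have b: "b \<in> l1_ball p (N - int n)"
      using less.prems abs3 i(1) unfolding b_def l1_ball_def
      by (auto simp: sum_fun_upd[where F = abs] simp del: fun_upd_apply) auto
    have "(\<Sum>j<p. \<bar>2 * a' j - 1\<bar>) < (\<Sum>j<p. \<bar>2 * a j - 1\<bar>)"
      using abs1 unfolding a'_def sum_fun_upd[OF i(1), where F = "\<lambda>x. \<bar>2 * x - 1\<bar>"] by simp
    moreover have "0 \<le> (\<Sum>j<p. \<bar>2 * a' j - 1\<bar>)" by (intro sum_nonneg) auto
    ultimately have "nat (\<Sum>j<p. \<bar>2 * a' j - 1\<bar>) < nat (\<Sum>j<p. \<bar>2 * a j - 1\<bar>)" by linarith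
    from less.hyps[OF this a'] obtain r h where r: "r \<in> trig_poly p (reduced_freqs p n)"
      and h: "\<And>i. i < p \<Longrightarrow> h i \<in> trig_poly p (l1_ball p (N - int n))"
      and eq: "\<And>\<theta>. torus_char p a' \<theta> = r \<theta> + (\<Sum>i<p. of_real (cos (real n * \<theta> i)) * h i \<theta>)"
      by blast
    define h' where "h' j \<theta> = - 1 * h j \<theta> + (if j = i then 2 else 0) * torus_char p b \<theta>" for j \<theta>
    have "(\<lambda>\<theta>. - 1 * r \<theta>) \<in> trig_poly p (reduced_freqs p n)" by (rule trig_poly_scale[OF r])
    moreover have "h' j \<in> trig_poly p (l1_ball p (N - int n))" if "j < p" for j
      unfolding h'_def using trig_poly_scale[OF h[OF that]] b by (rule trig_poly.add_char)
    moreover have "torus_char p a \<theta> = - 1 * r \<theta> + (\<Sum>i<p. of_real (cos (real n * \<theta> i)) * h' i \<theta>)" for \<theta>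
    proof -
      have cos: "cos (of_int s * \<theta> i) = cos (real n * \<theta> i)" by (simp add: s_def)
      have "torus_char p a \<theta> + torus_char p a' \<theta> = torus_char p a \<theta> * (1 + cis (- 2 * (of_int s * \<theta> i)))"
        unfolding a'_def torus_char_update[OF i(1)] by (simp add: algebra_simps)
      also have "\<dots> = 2 * of_real (cos (real n * \<theta> i)) * torus_char p b \<theta>"
        unfolding b_def torus_char_update[OF i(1)] one_add_cis_double cos by (simp add: algebra_simps)
      finally have "torus_char p a \<theta> = - 1 * torus_char p a' \<theta> + 2 * of_real (cos (real n * \<theta> i)) * torus_char p b \<theta>"
        by (simp add: algebra_simps add_eq_0_iff eq_neg_iff_add_eq_0)
      also have "2 * of_real (cos (real n * \<theta> i)) * torus_char p b \<theta> =
         (\<Sum>j<p. of_real (cos (real n * \<theta> j)) * ((if j = i then 2 else 0) * torus_char p b \<theta>))"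
      proof -
        have "(\<Sum>j<p. of_real (cos (real n * \<theta> j)) * ((if j = i then 2 else 0) * torus_char p b \<theta>)) =
           (\<Sum>j<p. if j = i then 2 * of_real (cos (real n * \<theta> i)) * torus_char p b \<theta> else 0)"
          by (rule sum.cong) auto
        then show ?thesis using i(1) by simp
      qed
      finally show ?thesis
        by (simp add: eq h'_def algebra_simps sum.distrib sum_negf sum_subtractf)
    qed
    ultimately show ?thesis by blast
  qed
qed

text \<open>One factor z_j - \<open>cis (q j)\<close> for each point q to be killed, with j a
  coordinate in which \<open>q0\<close> differs from q; hence the degree is at most the number of
  points.\<close>

lemma trig_poly_separating:
  assumes "finite S" "\<And>q. q \<in> S \<Longrightarrow> \<exists>j<p. cis (q0 j) \<noteq> cis (q j)"
  shows "\<exists>g \<in> trig_poly p (l1_ball p (int (card S))). g q0 \<noteq> 0 \<and> (\<forall>q\<in>S. g q = 0)"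
  using assms
proof induction
  case empty
  show ?case
    by (rule bexI[of _ "torus_char p (\<lambda>_. 0)"]) (auto intro!: trig_poly_char simp: l1_ball_def)
next
  case (insert q S)
  then obtain g where g: "g \<in> trig_poly p (l1_ball p (int (card S)))" "g q0 \<noteq> 0" "\<forall>q\<in>S. g q = 0"
    by auto
  obtain j where j: "j < p" "cis (q0 j) \<noteq> cis (q j)" using insert.prems by blast
  define f where "f \<theta> = cis (\<theta> j) - cis (q j)" for \<theta>
  have "(\<lambda>\<theta>. torus_char p (\<lambda>i. if i = j then 1 else 0) \<theta> + (- cis (q j)) * torus_char p (\<lambda>_. 0) \<theta>)
      \<in> trig_poly p (l1_ball p 1)"
    using j(1) by (intro trig_poly.add_char trig_poly_char) (auto simp: l1_ball_def if_distrib[of abs] cong: if_cong)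
  then have "f \<in> trig_poly p (l1_ball p 1)"
    by (simp add: torus_char_unit[OF j(1)] f_def[abs_def])
  from trig_poly_mult[OF this g(1) l1_ball_add]
  have "(\<lambda>\<theta>. f \<theta> * g \<theta>) \<in> trig_poly p (l1_ball p (int (card (insert q S))))"
    using insert.hyps by simp
  then show ?case
    by (rule bexI[rotated]) (use g j in \<open>auto simp: f_def\<close>)
qed

text \<open>If a functional \<open>\<lambda> = \<Sum>\<^sub>q c\<^sub>q ev\<^sub>q\<close> supported on common zeros kills the reduced characters, then
  dividing each character with remainder shows that the values of \<open>\<lambda>\<close> on all characters of degree
  at most \<open>K\<close> form an eigenvector for \<open>- t\<close> of a matrix that does not depend on \<open>t\<close>.\<close>
lemma perturbed_zero_count:
  assumes n: "0 < n" and f: "\<And>i. i < p \<Longrightarrow> f i \<in> trig_poly p (l1_ball p (int n))"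
  shows "\<exists>bad :: real set. finite bad \<and> (\<forall>t Q. t \<notin> bad \<longrightarrow> finite Q \<longrightarrow> card Q \<le> K \<longrightarrow>
    (\<forall>q\<in>Q. \<forall>q'\<in>Q. q \<noteq> q' \<longrightarrow> (\<exists>j<p. cis (q j) \<noteq> cis (q' j))) \<longrightarrow>
    (\<forall>q\<in>Q. \<forall>i<p. f i q + of_real (t * cos (real n * q i)) = 0) \<longrightarrow> card Q \<le> (2 * n) ^ p)"
proof -
  define I where "I = l1_ball p (int K)"
  have fin: "finite I" unfolding I_def by (rule finite_l1_ball)
  have "\<forall>a\<in>I. \<exists>rh. fst rh \<in> trig_poly p (reduced_freqs p n) \<and>
    (\<forall>i<p. snd rh i \<in> trig_poly p (l1_ball p (int K - int n))) \<and>
    (\<forall>\<theta>. torus_char p a \<theta> = fst rh \<theta> + (\<Sum>i<p. of_real (cos (real n * \<theta> i)) * snd rh i \<theta>))"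
    using torus_char_division[OF n, of _ p "int K"] unfolding I_def by simp
  from bchoice[OF this] obtain rh where rh: "\<forall>a\<in>I. fst (rh a) \<in> trig_poly p (reduced_freqs p n) \<and>
    (\<forall>i<p. snd (rh a) i \<in> trig_poly p (l1_ball p (int K - int n))) \<and>
    (\<forall>\<theta>. torus_char p a \<theta> = fst (rh a) \<theta> + (\<Sum>i<p. of_real (cos (real n * \<theta> i)) * snd (rh a) i \<theta>))"
    by (elim exE)
  define r where "r a = fst (rh a)" for a
  define h where "h a = snd (rh a)" for a
  have r: "r a \<in> trig_poly p (reduced_freqs p n)"
    and h: "\<And>i. i < p \<Longrightarrow> h a i \<in> trig_poly p (l1_ball p (int K - int n))"
    and div: "\<And>\<theta>. torus_char p a \<theta> = r a \<theta> + (\<Sum>i<p. of_real (cos (real n * \<theta> i)) * h a i \<theta>)"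
    if "a \<in> I" for a
    using bspec[OF rh that] unfolding r_def h_def by blast+
  \<comment> \<open>The degrees close up: n from \<open>f i\<close> and \<open>K - n\<close> from
    the quotient give K again. So replacing cos(n \<theta>_i) by \<open>f i\<close> in the division
    keeps the result in the span of the characters in \<open>I\<close>, with a coefficient matrix
    \<open>A\<close> free of t.\<close>
  have "\<forall>a\<in>I. \<exists>c. \<forall>\<theta>. (\<Sum>i<p. f i \<theta> * h a i \<theta>) = (\<Sum>b\<in>I. c b * torus_char p b \<theta>)"
  proof (intro ballI trig_poly_coeffs[OF trig_poly_sum fin])
    fix a i assume that: "a \<in> I" and "i \<in> {..<p}"
    then have "f i \<in> trig_poly p (l1_ball p (int n))" "h a i \<in> trig_poly p (l1_ball p (int K - int n))"
      using f h[OF that] by auto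
    then show "(\<lambda>\<theta>. f i \<theta> * h a i \<theta>) \<in> trig_poly p I"
      by (rule trig_poly_mult) (use l1_ball_add[of _ p "int n" _ "int K - int n"] in \<open>simp add: I_def\<close>)
  qed
  from bchoice[OF this] obtain A where
    "\<forall>a\<in>I. \<forall>\<theta>. (\<Sum>i<p. f i \<theta> * h a i \<theta>) = (\<Sum>b\<in>I. A a b * torus_char p b \<theta>)"
    by (elim exE)
  then have A: "\<And>a \<theta>. a \<in> I \<Longrightarrow> (\<Sum>i<p. f i \<theta> * h a i \<theta>) = (\<Sum>b\<in>I. A a b * torus_char p b \<theta>)"
    by blast
  define E where "E = {t. \<exists>x. (\<exists>a\<in>I. x a \<noteq> 0) \<and> (\<forall>a\<in>I. (\<Sum>b\<in>I. A a b * x b) = t * x a)}"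
  \<comment> \<open>The sign arises because \<open>t * cos (real n * q i)\<close> equals
    \<open>- f i q\<close> at a common zero.\<close>
  define bad :: "real set" where "bad = (\<lambda>t. - of_real t) -` E"
  have "finite bad"
    unfolding bad_def by (rule finite_vimageI) (auto simp: E_def inj_on_def intro: finite_eigenvalues_indexed[OF fin])
  moreover have "card Q \<le> (2 * n) ^ p"
    if t: "t \<notin> bad" and Q: "finite Q" "card Q \<le> K"
      and sep: "\<forall>q\<in>Q. \<forall>q'\<in>Q. q \<noteq> q' \<longrightarrow> (\<exists>j<p. cis (q j) \<noteq> cis (q' j))"
      and zeros: "\<forall>q\<in>Q. \<forall>i<p. f i q + of_real (t * cos (real n * q i)) = 0"
    for t :: real and Q
  proof (rule ccontr)
    assume "\<not> card Q \<le> (2 * n) ^ p"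
    then have less: "card (reduced_freqs p n) < card Q" using reduced_freqs_finite_card[of p n] by simp
    have finR: "finite (reduced_freqs p n)" using reduced_freqs_finite_card by blast
    obtain c q0 where q0: "q0 \<in> Q" "c q0 \<noteq> 0"
      and c: "\<And>a. a \<in> reduced_freqs p n \<Longrightarrow> (\<Sum>q\<in>Q. c q * torus_char p a q) = 0"
      using kernel_of_more_unknowns[OF Q(1) finR less, of "\<lambda>q a. torus_char p a q"] by blast
    define x where "x a = (\<Sum>q\<in>Q. c q * torus_char p a q)" for a
    have functional: "(\<Sum>q\<in>Q. c q * (\<Sum>a\<in>B. k a * torus_char p a q)) = (\<Sum>a\<in>B. k a * x a)" for B k
    proof -
      have "(\<Sum>q\<in>Q. c q * (\<Sum>a\<in>B. k a * torus_char p a q)) = (\<Sum>q\<in>Q. \<Sum>a\<in>B. k a * (c q * torus_char p a q))"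
        by (simp add: sum_distrib_left mult_ac)
      also have "\<dots> = (\<Sum>a\<in>B. \<Sum>q\<in>Q. k a * (c q * torus_char p a q))" by (rule sum.swap)
      finally show ?thesis by (simp add: x_def sum_distrib_left)
    qed
    have r0: "(\<Sum>q\<in>Q. c q * r a q) = 0" if a: "a \<in> I" for a
    proof -
      obtain k where "\<And>\<theta>. r a \<theta> = (\<Sum>b\<in>reduced_freqs p n. k b * torus_char p b \<theta>)"
        using trig_poly_coeffs[OF r[OF a] finR] by blast
      then have "(\<Sum>q\<in>Q. c q * r a q) = (\<Sum>b\<in>reduced_freqs p n. k b * x b)" by (simp add: functional)
      also have "\<dots> = 0" using c by (simp add: x_def)
      finally show ?thesis .
    qed
    \<comment> \<open>The functional is applied to the division identity of \<open>a\<close>: it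
      kills the remainder, and at the zeros the \<open>f i\<close> may be traded for -t times the
      cosines.\<close>
    have "(\<Sum>b\<in>I. A a b * x b) = - of_real t * x a" if a: "a \<in> I" for a
    proof -
      have "(\<Sum>b\<in>I. A a b * x b) = (\<Sum>q\<in>Q. c q * (\<Sum>i<p. f i q * h a i q))"
        by (simp add: functional[symmetric] A[OF a])
      also have "\<dots> = (\<Sum>q\<in>Q. c q * (- of_real t * (torus_char p a q - r a q)))"
      proof (rule sum.cong, simp)
        fix q assume q: "q \<in> Q"
        have fq: "f i q = - of_real t * of_real (cos (real n * q i))" if "i < p" for i
          using zeros q that by (simp add: eq_neg_iff_add_eq_0)
        have "(\<Sum>i<p. f i q * h a i q) = - of_real t * (\<Sum>i<p. of_real (cos (real n * q i)) * h a i q)"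
          unfolding sum_distrib_left by (rule sum.cong) (auto simp: fq)
        also have "\<dots> = - of_real t * (torus_char p a q - r a q)" using div[OF a, of q] by simp
        finally show "c q * (\<Sum>i<p. f i q * h a i q) = c q * (- of_real t * (torus_char p a q - r a q))"
          by simp
      qed
      also have "\<dots> = - of_real t * ((\<Sum>q\<in>Q. c q * torus_char p a q) - (\<Sum>q\<in>Q. c q * r a q))"
        by (simp add: sum_distrib_left sum_subtractf[symmetric] algebra_simps sum_negf)
      finally show ?thesis by (simp add: r0[OF a] x_def)
    qed
    \<comment> \<open>Otherwise the functional would kill a polynomial of degree at most K that
      vanishes on \<open>Q\<close> except at \<open>q0\<close>, forcing \<open>c q0 = 0\<close>. The
      bound \<open>card Q \<le> K\<close> makes that polynomial fit.\<close>
    moreover have "\<exists>a\<in>I. x a \<noteq> 0"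
    proof (rule ccontr)
      assume "\<not> ?thesis"
      then have x0: "\<And>a. a \<in> I \<Longrightarrow> x a = 0" by blast
      have "\<exists>g \<in> trig_poly p (l1_ball p (int (card (Q - {q0})))). g q0 \<noteq> 0 \<and> (\<forall>q\<in>Q - {q0}. g q = 0)"
        by (rule trig_poly_separating) (use Q(1) sep q0(1) in auto)
      then obtain g where g: "g \<in> trig_poly p (l1_ball p (int (card (Q - {q0}))))" "g q0 \<noteq> 0"
        "\<forall>q\<in>Q - {q0}. g q = 0" by blast
      have "card (Q - {q0}) \<le> K" using Q card_Diff1_le[of Q q0] by linarith
      then have "g \<in> trig_poly p I"
        unfolding I_def by (intro trig_poly_mono[OF g(1)]) (auto simp: l1_ball_def)
      then obtain k where "\<And>\<theta>. g \<theta> = (\<Sum>b\<in>I. k b * torus_char p b \<theta>)"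
        using trig_poly_coeffs fin by blast
      then have "(\<Sum>q\<in>Q. c q * g q) = 0" by (simp add: functional x0)
      moreover have "(\<Sum>q\<in>Q. c q * g q) = c q0 * g q0"
        using q0(1) Q(1) g(3) by (simp add: sum.remove[of Q q0])
      ultimately show False using q0(2) g(2) by simp
    qed
    ultimately have "- of_real t \<in> E" unfolding E_def by blast
    then show False using t by (simp add: bad_def)
  qed
  ultimately show ?thesis by blast
qed

section \<open>Counting local minima\<close>

lemma param_space_outside: "x \<in> param_space p \<Longrightarrow> \<not> j < p \<Longrightarrow> x j = 0"
  by (simp add: param_space_def)

text \<open>Chord against arc: displacement on the torus is controlled by displacement of the
  parameters.\<close>

lemma norm_cis_diff_le: "cmod (cis a - cis b) \<le> \<bar>a - b\<bar>"
proof -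
  have "cis a - cis b = cis b * (cis (a - b) - 1)" by (simp add: cis_mult algebra_simps)
  then have "cmod (cis a - cis b) = cmod (exp (\<i> * of_real (a - b)) - 1)"
    by (simp add: norm_mult cis_conv_exp)
  also have "\<dots> = 2 * \<bar>sin ((a - b) / 2)\<bar>" by (rule dist_exp_i_1)
  also have "\<dots> \<le> \<bar>a - b\<bar>" using abs_sin_x_le_abs_x[of "(a - b) / 2"] by simp
  finally show ?thesis .
qed

text \<open>The imaginary part of a real-valued function is constantly zero, so its complex
  derivative is real; the real gradient is again a trigonometric polynomial with the same
  frequencies.\<close>

lemma trig_poly_real_partial_derivs:
  fixes L :: "(nat \<Rightarrow> real) \<Rightarrow> real"
  assumes "(\<lambda>\<theta>. complex_of_real (L \<theta>)) \<in> trig_poly p A"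
  shows "\<exists>D. \<forall>l<p. (\<lambda>\<theta>. complex_of_real (D l \<theta>)) \<in> trig_poly p A \<and>
    (\<forall>\<theta>. ((\<lambda>t. L (\<theta>(l := t))) has_real_derivative D l \<theta>) (at (\<theta> l)))"
proof -
  have "\<exists>D. (\<lambda>\<theta>. complex_of_real (D \<theta>)) \<in> trig_poly p A \<and>
    (\<forall>\<theta>. ((\<lambda>t. L (\<theta>(l := t))) has_real_derivative D \<theta>) (at (\<theta> l)))" if l: "l < p" for l
  proof -
    obtain f' where f': "f' \<in> trig_poly p A"
      and der: "\<And>\<theta>. ((\<lambda>t. complex_of_real (L (\<theta>(l := t)))) has_vector_derivative f' \<theta>) (at (\<theta> l))"
      using trig_poly_partial_deriv[OF assms l] by blast
    have Re: "((\<lambda>t. L (\<theta>(l := t))) has_vector_derivative Re (f' \<theta>)) (at (\<theta> l))" for \<theta>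
      using bounded_linear.has_vector_derivative[OF bounded_linear_Re der[of \<theta>]] by simp
    have "((\<lambda>t. 0) has_vector_derivative Im (f' \<theta>)) (at (\<theta> l))" for \<theta>
      using bounded_linear.has_vector_derivative[OF bounded_linear_Im der[of \<theta>]] by simp
    then have "Im (f' \<theta>) = 0" for \<theta>
      using vector_derivative_unique_at[OF _ has_vector_derivative_const] by blast
    then have "(\<lambda>\<theta>. complex_of_real (Re (f' \<theta>))) = f'" by (auto simp: complex_eq_iff)
    then show ?thesis
      using f' Re by (intro exI[of _ "\<lambda>\<theta>. Re (f' \<theta>)"]) (simp add: has_real_derivative_iff_has_vector_derivative)
  qed
  then have "\<forall>l\<in>{..<p}. \<exists>D. (\<lambda>\<theta>. complex_of_real (D \<theta>)) \<in> trig_poly p A \<and>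
    (\<forall>\<theta>. ((\<lambda>t. L (\<theta>(l := t))) has_real_derivative D \<theta>) (at (\<theta> l)))" by blast
  from bchoice[OF this] show ?thesis by blast
qed

section \<open>Compact cubes in parameter space and their boundaries\<close>

definition param_cube :: "nat \<Rightarrow> (nat \<Rightarrow> real) \<Rightarrow> real \<Rightarrow> (nat \<Rightarrow> real) set" where
  "param_cube p m r = {x \<in> param_space p. \<forall>j<p. \<bar>x j - m j\<bar> \<le> r}"

text \<open>The boundary of the cube in the maximum norm, the norm implicit in
  \<open>local_min\<close>; empty for \<open>p = 0\<close>.\<close>

definition param_sphere :: "nat \<Rightarrow> (nat \<Rightarrow> real) \<Rightarrow> real \<Rightarrow> (nat \<Rightarrow> real) set" where
  "param_sphere p m r = {x \<in> param_cube p m r. \<exists>j<p. \<bar>x j - m j\<bar> = r}"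

text \<open>Tychonoff: the cube is a product of compact intervals and, from coordinate p on, of
  singletons.\<close>

lemma compact_param_cube: "compact (param_cube p m r)"
proof -
  let ?B = "PiE UNIV (\<lambda>j. if j < p then {m j - r..m j + r} else {0})"
  have "compactin (product_topology (\<lambda>_. euclidean) UNIV) ?B"
    by (subst compactin_PiE) auto
  then have "compact ?B" by (simp add: euclidean_product_topology)
  moreover have "param_cube p m r = ?B"
  proof (intro equalityI subsetI)
    fix x assume x: "x \<in> param_cube p m r"
    have "x j \<in> (if j < p then {m j - r..m j + r} else {0})" for j
      using x unfolding param_cube_def param_space_def by (cases "j < p") (force simp: abs_le_iff)+
    then show "x \<in> ?B" by auto
  next
    fix x assume x: "x \<in> ?B"
    have "x j \<in> (if j < p then {m j - r..m j + r} else {0})" for j using x by blast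
    then have "x j = 0" if "\<not> j < p" for j using that by (metis singletonD)
    moreover have "\<bar>x j - m j\<bar> \<le> r" if "j < p" for j
      using \<open>\<And>j. x j \<in> _\<close>[of j] that by (simp add: abs_le_iff)
    ultimately show "x \<in> param_cube p m r" by (auto simp: param_cube_def param_space_def)
  qed
  ultimately show ?thesis by simp
qed

lemma compact_param_sphere: "compact (param_sphere p m r)"
proof -
  have "closed {x :: nat \<Rightarrow> real. \<bar>x j - m j\<bar> = r}" for j
    by (intro closed_Collect_eq continuous_intros continuous_on_product_coordinates)
  then have "closed (\<Union>j<p. {x :: nat \<Rightarrow> real. \<bar>x j - m j\<bar> = r})" by (intro closed_UN) auto
  then have "compact (param_cube p m r \<inter> (\<Union>j<p. {x. \<bar>x j - m j\<bar> = r}))"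
    by (intro compact_Int_closed compact_param_cube)
  also have "param_cube p m r \<inter> (\<Union>j<p. {x. \<bar>x j - m j\<bar> = r}) = param_sphere p m r"
    by (auto simp: param_sphere_def)
  finally show ?thesis .
qed

section \<open>Reduction to the fundamental period box\<close>

definition wrap_period :: "nat \<Rightarrow> (nat \<Rightarrow> real) \<Rightarrow> nat \<Rightarrow> real" where
  "wrap_period p x j = (if j < p then x j - 2 * pi * of_int \<lfloor>x j / (2 * pi)\<rfloor> else 0)"

lemma wrap_period_in_box: "wrap_period p x \<in> period_box p"
proof -
  have "0 \<le> wrap_period p x j \<and> wrap_period p x j < 2 * pi" if "j < p" for j
  proof -
    have "of_int \<lfloor>x j / (2 * pi)\<rfloor> * (2 * pi) \<le> x j" "x j < (of_int \<lfloor>x j / (2 * pi)\<rfloor> + 1) * (2 * pi)"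
      by (intro floor_divide_lower floor_divide_upper; simp)+
    then show ?thesis using that by (simp add: wrap_period_def algebra_simps)
  qed
  then show ?thesis by (auto simp: period_box_def param_space_def wrap_period_def)
qed

lemma cis_wrap_period: "j < p \<Longrightarrow> cis (wrap_period p x j) = cis (x j)"
proof -
  assume "j < p"
  then have "cis (wrap_period p x j) = cis (x j) / cis (2 * pi * of_int \<lfloor>x j / (2 * pi)\<rfloor>)"
    unfolding cis_divide by (simp only: wrap_period_def if_True)
  also have "cis (2 * pi * of_int \<lfloor>x j / (2 * pi)\<rfloor>) = 1" by (rule cis_multiple_2pi) simp
  finally show ?thesis by simp
qed

text \<open>Points with the same image differ by multiples of 2 pi, which must be zero in a small
  set. This carries finiteness in the period box over to a window around any point.\<close>

lemma wrap_period_inj_on: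
  assumes "\<And>x y j. x \<in> S \<Longrightarrow> y \<in> S \<Longrightarrow> j < p \<Longrightarrow> \<bar>x j - y j\<bar> < 2 * pi" "S \<subseteq> param_space p"
  shows "inj_on (wrap_period p) S"
proof (rule inj_onI)
  fix x y assume xy: "x \<in> S" "y \<in> S" "wrap_period p x = wrap_period p y"
  have "x j = y j" for j
  proof (cases "j < p")
    case True
    define k where "k = \<lfloor>x j / (2 * pi)\<rfloor> - \<lfloor>y j / (2 * pi)\<rfloor>"
    have "x j - y j = 2 * pi * of_int k"
      using fun_cong[OF xy(3), of j] True by (simp add: wrap_period_def k_def algebra_simps)
    moreover from this have "2 * pi * \<bar>of_int k\<bar> < 2 * pi * 1"
      using assms(1)[OF xy(1,2) True] by (simp add: abs_mult)
    then have "\<bar>of_int k\<bar> < (1 :: real)" by (subst (asm) mult_less_cancel_left_pos) simp_all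
    then have "k = 0" by linarith
    ultimately show ?thesis by simp
  next
    case False
    then show ?thesis using xy(1,2) assms(2) param_space_outside[OF _ False] by (metis subsetD)
  qed
  then show "x = y" by blast
qed

text \<open>Smallness conditions on the radius and on t are collected in the filter
  \<open>at_right 0\<close>, where finitely many of them hold at once without explicit
  minima.\<close>

lemma eventually_at_right_0_lt: "0 < c \<Longrightarrow> eventually (\<lambda>r. r < c) (at_right (0::real))"
  using eventually_at_right_real[of 0 c] by (auto elim: eventually_mono)

lemma period_box_cis_separated:
  assumes "m \<in> period_box p" "m' \<in> period_box p" "m \<noteq> m'"
  shows "\<exists>j<p. cis (m j) \<noteq> cis (m' j)"
proof (rule ccontr)
  assume "\<not> ?thesis"
  then have eq: "cis (m j) = cis (m' j)" if "j < p" for j using that by blast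
  have "m j = m' j" for j
  proof (cases "j < p")
    case True
    then have "0 \<le> m j" "m j < 2 * pi" "0 \<le> m' j" "m' j < 2 * pi"
      using assms by (auto simp: period_box_def)
    then have "Arg2pi (cis (m j)) = m j" "Arg2pi (cis (m' j)) = m' j"
      by (auto intro!: Arg2pi_unique[of 1] simp: cis_conv_exp)
    then show ?thesis using eq[OF True] by metis
  next
    case False
    then show ?thesis using assms param_space_outside[of m p j] param_space_outside[of m' p j] by (simp add: period_box_def)
  qed
  then show False using assms(3) by blast
qed

lemma local_min_imp_partial_deriv_zero:
  assumes "local_min p L x" "l < p" "((\<lambda>t. L (x(l := t))) has_real_derivative D) (at (x l))"
  shows "D = 0"
proof -
  obtain e where e: "e > 0" "\<And>y. y \<in> param_space p \<Longrightarrow> \<forall>i<p. \<bar>y i - x i\<bar> < e \<Longrightarrow> L x \<le> L y"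
    and x: "x \<in> param_space p"
    using assms(1) unfolding local_min_def by blast
  have "L (x(l := x l)) \<le> L (x(l := t))" if "\<bar>x l - t\<bar> < e" for t
    using e x that assms(2) by (auto simp: param_space_def abs_minus_commute intro!: e(2))
  then show ?thesis using DERIV_local_min[OF assms(3) e(1)] by blast
qed

text \<open>If \<open>L x = L m\<close> on a small sphere, then x is itself a local minimum, since a
  neighbourhood of x lies in that of m, and hence x is critical. Only finitely many critical points
  are near m, and small radii avoid them.\<close>

lemma isolated_local_min_sphere:
  fixes L :: "(nat \<Rightarrow> real) \<Rightarrow> real"
  assumes L: "(\<lambda>\<theta>. complex_of_real (L \<theta>)) \<in> trig_poly p A"
    and fin: "finite {\<theta> \<in> period_box p. critical_point p L \<theta>}"
    and m: "local_min p L m"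
  shows "eventually (\<lambda>r. \<forall>x\<in>param_sphere p m r. L m < L x) (at_right 0)"
proof -
  obtain D where Dt: "\<And>l. l < p \<Longrightarrow> (\<lambda>\<theta>. complex_of_real (D l \<theta>)) \<in> trig_poly p A"
    and D: "\<And>l \<theta>. l < p \<Longrightarrow> ((\<lambda>t. L (\<theta>(l := t))) has_real_derivative D l \<theta>) (at (\<theta> l))"
    using trig_poly_real_partial_derivs[OF L] by blast
  have crit: "critical_point p L x \<longleftrightarrow> x \<in> param_space p \<and> (\<forall>l<p. D l x = 0)" for x
    unfolding critical_point_def using D DERIV_unique by metis
  obtain e where e: "e > 0" "\<And>y. y \<in> param_space p \<Longrightarrow> \<forall>i<p. \<bar>y i - m i\<bar> < e \<Longrightarrow> L m \<le> L y"
    and mp: "m \<in> param_space p"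
    using m unfolding local_min_def by blast
  \<comment> \<open>The window is centred at \<open>m\<close> because \<open>m\<close> may sit on
    the edge of the period box; half-width pi keeps \<open>wrap_period\<close> injective on
    it.\<close>
  define Z where "Z = {x. critical_point p L x \<and> x \<noteq> m \<and> (\<forall>j<p. \<bar>x j - m j\<bar> < pi)}"
  have Zp: "Z \<subseteq> param_space p" by (auto simp: Z_def critical_point_def)
  have "inj_on (wrap_period p) Z"
  proof (rule wrap_period_inj_on[OF _ Zp])
    fix x y j assume "x \<in> Z" "y \<in> Z" "j < p"
    then have "\<bar>x j - m j\<bar> < pi" "\<bar>y j - m j\<bar> < pi" by (auto simp: Z_def)
    then show "\<bar>x j - y j\<bar> < 2 * pi" by linarith
  qed
  moreover have "wrap_period p ` Z \<subseteq> {\<theta> \<in> period_box p. critical_point p L \<theta>}"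
  proof (rule image_subsetI)
    fix x assume x: "x \<in> Z"
    have "D l (wrap_period p x) = D l x" if "l < p" for l
      using trig_poly_cong[OF Dt[OF that] cis_wrap_period] by simp
    then show "wrap_period p x \<in> {\<theta> \<in> period_box p. critical_point p L \<theta>}"
      using x wrap_period_in_box[of p x] by (auto simp: Z_def crit period_box_def)
  qed
  ultimately have "finite Z" using fin finite_imageD finite_subset by blast
  have "\<forall>z\<in>Z. eventually (\<lambda>r. \<exists>j<p. r < \<bar>z j - m j\<bar>) (at_right 0)"
  proof
    fix z assume z: "z \<in> Z"
    have "\<exists>j<p. z j \<noteq> m j"
    proof (rule ccontr)
      assume "\<not> ?thesis"
      then have "z j = m j" for j
        using subsetD[OF Zp z] mp by (cases "j < p") (simp_all add: param_space_outside[of z p] param_space_outside[of m p])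
      then show False using z by (auto simp: Z_def)
    qed
    then obtain j where j: "j < p" "0 < \<bar>z j - m j\<bar>" by auto
    show "eventually (\<lambda>r. \<exists>j<p. r < \<bar>z j - m j\<bar>) (at_right 0)"
      using eventually_at_right_0_lt[OF j(2)] by (rule eventually_mono) (use j(1) in blast)
  qed
  then have "eventually (\<lambda>r. \<forall>z\<in>Z. \<exists>j<p. r < \<bar>z j - m j\<bar>) (at_right 0)"
    by (rule eventually_ball_finite[OF \<open>finite Z\<close>])
  then show ?thesis
    using eventually_at_right_0_lt[OF e(1)] eventually_at_right_0_lt[OF pi_gt_zero]
      eventually_at_right_less[of "0::real"]
  proof eventually_elim
    case (elim r)
    show ?case
    proof
      fix x assume "x \<in> param_sphere p m r"
      then have x: "x \<in> param_space p" "\<And>j. j < p \<Longrightarrow> \<bar>x j - m j\<bar> \<le> r" "\<exists>j<p. \<bar>x j - m j\<bar> = r"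
        by (auto simp: param_sphere_def param_cube_def)
      have le: "L m \<le> L x"
      proof (rule e(2)[OF x(1)], intro allI impI)
        fix i assume "i < p"
        then show "\<bar>x i - m i\<bar> < e" using x(2)[of i] elim(2) by simp
      qed
      show "L m < L x"
      proof (rule ccontr)
        assume "\<not> L m < L x"
        then have eq: "L x = L m" using le by simp
        have "local_min p L x"
          unfolding local_min_def
        proof (intro conjI exI[of _ "e - r"] ballI impI)
          show "x \<in> param_space p" "0 < e - r" using x(1) elim(2) by auto
          fix y assume y: "y \<in> param_space p" "\<forall>i<p. \<bar>y i - x i\<bar> < e - r"
          have "\<bar>y i - m i\<bar> < e" if "i < p" for i
            using y(2)[rule_format, OF that] x(2)[OF that] by linarith
          then show "L x \<le> L y" using e(2)[OF y(1)] eq by simp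
        qed
        then have "critical_point p L x"
          using local_min_imp_partial_deriv_zero D x(1) by (auto simp: crit)
        moreover have "x \<noteq> m" using x(3) elim(4) by auto
        moreover have "\<bar>x j - m j\<bar> < pi" if "j < p" for j
          using x(2)[OF that] elim(3) by linarith
        ultimately have "x \<in> Z" by (simp add: Z_def)
        then obtain j where "j < p" "r < \<bar>x j - m j\<bar>" using elim(1) by blast
        then show False using x(2)[of j] by simp
      qed
    qed
  qed
qed

text \<open>Strict minima survive a small perturbation of the function, and the perturbation by
  \<open>(t / n) \<Sum>\<^sub>j sin (n \<theta>\<^sub>j)\<close> turns the gradient system into the perturbed system counted above.\<close>
lemma trig_poly_local_min_count:
  fixes L :: "(nat \<Rightarrow> real) \<Rightarrow> real"
  assumes L: "(\<lambda>\<theta>. complex_of_real (L \<theta>)) \<in> trig_poly p (l1_ball p (int n))" and n: "0 < n"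
    and fin: "finite {\<theta> \<in> period_box p. critical_point p L \<theta>}"
  shows "finite {\<theta> \<in> period_box p. local_min p L \<theta>} \<and>
    card {\<theta> \<in> period_box p. local_min p L \<theta>} \<le> (2 * n) ^ p"
proof -
  obtain D where Dt: "\<And>l. l < p \<Longrightarrow> (\<lambda>\<theta>. complex_of_real (D l \<theta>)) \<in> trig_poly p (l1_ball p (int n))"
    and D: "\<And>l \<theta>. l < p \<Longrightarrow> ((\<lambda>t. L (\<theta>(l := t))) has_real_derivative D l \<theta>) (at (\<theta> l))"
    using trig_poly_real_partial_derivs[OF L] by blast
  define S where "S = {\<theta> \<in> period_box p. local_min p L \<theta>}"
  have "S \<subseteq> {\<theta> \<in> period_box p. critical_point p L \<theta>}"
  proof
    fix x assume x: "x \<in> S"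
    have "((\<lambda>t. L (x(l := t))) has_real_derivative 0) (at (x l))" if "l < p" for l
      using D[OF that, of x] local_min_imp_partial_deriv_zero[OF _ that D[OF that]] x by (auto simp: S_def)
    then show "x \<in> {\<theta> \<in> period_box p. critical_point p L \<theta>}"
      using x by (auto simp: S_def critical_point_def local_min_def)
  qed
  then have finS: "finite S" using fin finite_subset by blast
  \<comment> \<open>Each minimum will be replaced by a point less than r away in every coordinate;
    chords longer than 2r keep the replacements distinct on the torus.\<close>
  have "\<forall>m\<in>S. \<forall>m'\<in>S - {m}. eventually (\<lambda>r. \<exists>j<p. 2 * r < cmod (cis (m j) - cis (m' j))) (at_right 0)"
  proof (intro ballI)
    fix m m' assume "m \<in> S" "m' \<in> S - {m}"
    then obtain j where j: "j < p" "cis (m j) \<noteq> cis (m' j)"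
      using period_box_cis_separated[of m p m'] by (auto simp: S_def)
    then have "0 < cmod (cis (m j) - cis (m' j)) / 2" by simp
    from eventually_at_right_0_lt[OF this]
    show "eventually (\<lambda>r. \<exists>j<p. 2 * r < cmod (cis (m j) - cis (m' j))) (at_right 0)"
      by (rule eventually_mono) (use j(1) in auto)
  qed
  then have "eventually (\<lambda>r. \<forall>m\<in>S. \<forall>m'\<in>S - {m}. \<exists>j<p. 2 * r < cmod (cis (m j) - cis (m' j))) (at_right 0)"
    using finS by (intro eventually_ball_finite ballI) auto
  moreover have "eventually (\<lambda>r. \<forall>m\<in>S. \<forall>x\<in>param_sphere p m r. L m < L x) (at_right 0)"
    using isolated_local_min_sphere[OF L fin] by (intro eventually_ball_finite[OF finS]) (auto simp: S_def)
  ultimately have "eventually (\<lambda>r. 0 < r \<and> (\<forall>m\<in>S. \<forall>m'\<in>S - {m}. \<exists>j<p. 2 * r < cmod (cis (m j) - cis (m' j)))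
      \<and> (\<forall>m\<in>S. \<forall>x\<in>param_sphere p m r. L m < L x)) (at_right (0::real))"
    using eventually_at_right_less[of "0::real"] by eventually_elim blast
  from eventually_happens'[OF trivial_limit_at_right_real this] obtain r :: real where r: "0 < r"
    and sep_all: "\<forall>m\<in>S. \<forall>m'\<in>S - {m}. \<exists>j<p. 2 * r < cmod (cis (m j) - cis (m' j))"
    and strict: "\<forall>m\<in>S. \<forall>x\<in>param_sphere p m r. L m < L x"
    by (elim exE conjE)
  have sep: "\<exists>j<p. 2 * r < cmod (cis (m j) - cis (m' j))" if "m \<in> S" "m' \<in> S" "m' \<noteq> m" for m m'
    using sep_all that by (elim ballE[where x = m] ballE[where x = m']) auto
  have contL: "continuous_on X L" for X
  proof -
    have "continuous_on UNIV (\<lambda>\<theta>. Re (complex_of_real (L \<theta>)))"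
      by (intro continuous_on_Re continuous_on_trig_poly[OF L])
    then show ?thesis by (auto intro: continuous_on_subset)
  qed
  have gap: "\<exists>\<eta>>0. \<forall>x\<in>param_sphere p m r. L m + \<eta> \<le> L x" if m: "m \<in> S" for m
  proof (cases "param_sphere p m r = {}")
    case True
    then show ?thesis by (intro exI[of _ 1]) auto
  next
    case False
    obtain x0 where "x0 \<in> param_sphere p m r" "\<forall>x\<in>param_sphere p m r. L x0 \<le> L x"
      using continuous_attains_inf[OF compact_param_sphere False contL] by blast
    moreover from this have "L m < L x0" using strict m by blast
    ultimately show ?thesis by (intro exI[of _ "L x0 - L m"]) auto
  qed
  \<comment> \<open>The perturbation will be bounded by \<open>t * real p\<close>, so two of its
    values differ by at most twice that.\<close>
  have "eventually (\<lambda>t. \<forall>x\<in>param_sphere p m r. 2 * (t * real p) < L x - L m) (at_right 0)" if m: "m \<in> S" for m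
  proof -
    obtain \<eta> where \<eta>: "\<eta> > 0" "\<And>x. x \<in> param_sphere p m r \<Longrightarrow> L m + \<eta> \<le> L x" using gap[OF m] by blast
    have "0 < \<eta> / (2 * (real p + 1))" using \<eta>(1) by simp
    from eventually_at_right_0_lt[OF this] show ?thesis
      using eventually_at_right_less[of "0::real"]
    proof eventually_elim
      case (elim t)
      then have "2 * (t * real p) < \<eta>" by (simp add: field_simps)
      then show ?case using \<eta>(2) by fastforce
    qed
  qed
  then have ev_gap: "eventually (\<lambda>t. \<forall>m\<in>S. \<forall>x\<in>param_sphere p m r. 2 * (t * real p) < L x - L m) (at_right 0)"
    by (intro eventually_ball_finite[OF finS]) blast
  \<comment> \<open>The degree parameter is the number of minima, known before t is chosen, so the
    excluded values of t are fixed in advance.\<close>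
  obtain bad :: "real set" where bad: "finite bad" and count: "\<And>t Q. t \<notin> bad \<Longrightarrow> finite Q \<Longrightarrow> card Q \<le> card S \<Longrightarrow>
    (\<forall>q\<in>Q. \<forall>q'\<in>Q. q \<noteq> q' \<longrightarrow> (\<exists>j<p. cis (q j) \<noteq> cis (q' j))) \<Longrightarrow>
    (\<forall>q\<in>Q. \<forall>i<p. complex_of_real (D i q) + of_real (t * cos (real n * q i)) = 0) \<Longrightarrow> card Q \<le> (2 * n) ^ p"
    using perturbed_zero_count[OF n, of p "\<lambda>i \<theta>. complex_of_real (D i \<theta>)" "card S"] Dt by blast
  have "\<forall>b\<in>bad. eventually (\<lambda>t. t \<noteq> b) (at_right 0)"
  proof
    fix b :: real
    show "eventually (\<lambda>t. t \<noteq> b) (at_right 0)"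
    proof (cases "b > 0")
      case True
      show ?thesis using eventually_at_right_0_lt[OF True] by eventually_elim simp
    next
      case False
      show ?thesis using eventually_at_right_less[of "0::real"] by eventually_elim (use False in auto)
    qed
  qed
  then have "eventually (\<lambda>t. \<forall>b\<in>bad. t \<noteq> b) (at_right 0)" by (rule eventually_ball_finite[OF bad])
  with ev_gap eventually_at_right_less[of "0::real"]
  have "eventually (\<lambda>t. (\<forall>m\<in>S. \<forall>x\<in>param_sphere p m r. 2 * (t * real p) < L x - L m) \<and> t \<notin> bad \<and> 0 < t)
     (at_right (0::real))"
    by eventually_elim blast
  from eventually_happens'[OF trivial_limit_at_right_real this] obtain t :: real
    where t_gap_all: "\<forall>m\<in>S. \<forall>x\<in>param_sphere p m r. 2 * (t * real p) < L x - L m"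
      and t: "t \<notin> bad" "0 < t"
    by (elim exE conjE)
  have t_gap: "2 * (t * real p) < L x - L m" if "m \<in> S" "x \<in> param_sphere p m r" for m x
    using t_gap_all that by blast
  \<comment> \<open>The amplitude \<open>t / real n\<close> cancels the factor n from
    differentiation, leaving exactly \<open>t * cos (real n * x l)\<close> in the gradient.\<close>
  define W where "W x = (t / real n) * (\<Sum>j<p. sin (real n * x j))" for x :: "nat \<Rightarrow> real"
  have W_bound: "\<bar>W x\<bar> \<le> t * real p" for x
  proof -
    have "\<bar>\<Sum>j<p. sin (real n * x j)\<bar> \<le> (\<Sum>j<p. \<bar>sin (real n * x j)\<bar>)" by (rule sum_abs)
    also have "\<dots> \<le> (\<Sum>j<p. 1)" by (intro sum_mono) simp
    finally have "\<bar>\<Sum>j<p. sin (real n * x j)\<bar> \<le> real p" by simp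
    moreover have "t / real n \<le> t" using n t(2) by (simp add: divide_le_eq)
    ultimately have "(t / real n) * \<bar>\<Sum>j<p. sin (real n * x j)\<bar> \<le> t * real p"
      using t(2) by (intro mult_mono) auto
    then show ?thesis using t(2) by (simp add: W_def abs_mult)
  qed
  have W_der: "((\<lambda>s. W (x(l := s))) has_real_derivative t * cos (real n * x l)) (at (x l))" if l: "l < p" for x l
  proof -
    have "W (x(l := s)) = (t / real n) * (sin (real n * s) + (\<Sum>j\<in>{..<p} - {l}. sin (real n * x j)))" for s
    proof -
      have "(\<Sum>j\<in>{..<p} - {l}. sin (real n * (x(l := s)) j)) = (\<Sum>j\<in>{..<p} - {l}. sin (real n * x j))"
        by (rule sum.cong) auto
      then show ?thesis using l by (simp add: W_def sum.remove[of "{..<p}" l])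
    qed
    then show ?thesis using n by (auto intro!: derivative_eq_intros)
  qed
  have contW: "continuous_on X W" for X
  proof -
    have "continuous_on UNIV W"
      unfolding W_def by (intro continuous_intros continuous_on_product_coordinates)
    then show ?thesis by (auto intro: continuous_on_subset)
  qed
  \<comment> \<open>Compactness gives a minimum of the perturbed function on the closed cube. On the
    boundary the gap exceeds what the perturbation can make up, so the minimum is interior and its
    gradient vanishes.\<close>
  have "\<exists>q. (\<forall>j<p. \<bar>q j - m j\<bar> < r) \<and> (\<forall>i<p. D i q + t * cos (real n * q i) = 0)" if m: "m \<in> S" for m
  proof -
    have mc: "m \<in> param_cube p m r"
      using m r by (auto simp: S_def period_box_def param_cube_def)
    then obtain q where q: "q \<in> param_cube p m r" and q_min: "\<And>x. x \<in> param_cube p m r \<Longrightarrow> L q + W q \<le> L x + W x"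
      using continuous_attains_inf[OF compact_param_cube, of p m r "\<lambda>x. L x + W x"]
        continuous_on_add[OF contL contW] by blast
    have "q \<notin> param_sphere p m r"
    proof
      assume "q \<in> param_sphere p m r"
      from t_gap[OF m this] show False
        using q_min[OF mc] W_bound[of q] W_bound[of m] by linarith
    qed
    then have q_int: "\<bar>q j - m j\<bar> < r" if "j < p" for j
      using q that by (force simp: param_sphere_def param_cube_def)
    have "D i q + t * cos (real n * q i) = 0" if i: "i < p" for i
    proof (rule DERIV_local_min)
      show "((\<lambda>s. L (q(i := s)) + W (q(i := s))) has_real_derivative D i q + t * cos (real n * q i)) (at (q i))"
        by (intro DERIV_add D W_der i)
      show "0 < r - \<bar>q i - m i\<bar>" using q_int[OF i] by simp
      show "\<forall>s. \<bar>q i - s\<bar> < r - \<bar>q i - m i\<bar> \<longrightarrow> L (q(i := q i)) + W (q(i := q i)) \<le> L (q(i := s)) + W (q(i := s))"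
      proof (intro allI impI)
        fix s assume "\<bar>q i - s\<bar> < r - \<bar>q i - m i\<bar>"
        then have "\<bar>s - m i\<bar> \<le> r" by linarith
        then have "q(i := s) \<in> param_cube p m r"
          using q i by (auto simp: param_cube_def param_space_def)
        from q_min[OF this] show "L (q(i := q i)) + W (q(i := q i)) \<le> L (q(i := s)) + W (q(i := s))" by simp
      qed
    qed
    with q_int show ?thesis by blast
  qed
  then have "\<forall>m\<in>S. \<exists>q. (\<forall>j<p. \<bar>q j - m j\<bar> < r) \<and> (\<forall>i<p. D i q + t * cos (real n * q i) = 0)" by blast
  from bchoice[OF this] obtain q where q_near: "\<And>m j. m \<in> S \<Longrightarrow> j < p \<Longrightarrow> \<bar>q m j - m j\<bar> < r"
    and q_zero: "\<And>m i. m \<in> S \<Longrightarrow> i < p \<Longrightarrow> D i (q m) + t * cos (real n * q m i) = 0" by blast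
  have q_sep: "\<exists>j<p. cis (q m j) \<noteq> cis (q m' j)" if m: "m \<in> S" "m' \<in> S" "m' \<noteq> m" for m m'
  proof -
    obtain j where j: "j < p" "2 * r < cmod (cis (m j) - cis (m' j))" using sep[OF m] by blast
    have "cmod (cis (m j) - cis (q m j)) < r" "cmod (cis (q m' j) - cis (m' j)) < r"
      using norm_cis_diff_le[of "m j" "q m j"] norm_cis_diff_le[of "q m' j" "m' j"]
        q_near[OF m(1) j(1)] q_near[OF m(2) j(1)] by linarith+
    then have "cis (q m j) \<noteq> cis (q m' j)"
      using j(2) norm_triangle_ineq[of "cis (m j) - cis (q m j)" "cis (q m j) - cis (m' j)"] by auto
    with j(1) show ?thesis by blast
  qed
  have inj: "inj_on q S"
  proof (rule inj_onI, rule ccontr)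
    fix m m' assume "m \<in> S" "m' \<in> S" "q m = q m'" "m \<noteq> m'"
    then show False using q_sep[of m m'] by auto
  qed
  have "card (q ` S) \<le> (2 * n) ^ p"
  proof (rule count[OF t(1)])
    show "finite (q ` S)" using finS by simp
    show "card (q ` S) \<le> card S" by (rule card_image_le[OF finS])
    show "\<forall>a\<in>q ` S. \<forall>b\<in>q ` S. a \<noteq> b \<longrightarrow> (\<exists>j<p. cis (a j) \<noteq> cis (b j))"
      using q_sep by blast
    show "\<forall>a\<in>q ` S. \<forall>i<p. complex_of_real (D i a) + of_real (t * cos (real n * a i)) = 0"
    proof (intro ballI allI impI)
      fix a i assume "a \<in> q ` S" "i < p"
      then have "D i a + t * cos (real n * a i) = 0" using q_zero by blast
      then have "complex_of_real (D i a + t * cos (real n * a i)) = 0" by (simp only: of_real_0)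
      then show "complex_of_real (D i a) + of_real (t * cos (real n * a i)) = 0" by (simp only: of_real_add)
    qed
  qed
  then show ?thesis using finS card_image[OF inj] by (simp add: S_def)
qed

section \<open>Spectral form of the exponential of a Hermitian matrix\<close>

text \<open>Such an entry lies inside one block, just above the diagonal, so both neighbouring
  diagonal entries are the eigenvalue of that block. This turns two adjacent columns into a
  generalised eigenvector chain.\<close>

lemma jordan_matrix_off_diagonal:
  fixes n_as :: "(nat \<times> 'a::{zero,one}) list"
  assumes "i < sum_list (map fst n_as)" "j < sum_list (map fst n_as)"
    "jordan_matrix n_as $$ (i, j) \<noteq> 0" "i \<noteq> j"
  shows "j = Suc i \<and> jordan_matrix n_as $$ (i, j) = 1 \<and> jordan_matrix n_as $$ (i, i) = jordan_matrix n_as $$ (j, j)"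
  using assms
proof (induction n_as arbitrary: i j)
  case Nil
  then show ?case by simp
next
  case (Cons na n_as)
  obtain n a where na: "na = (n, a)" by force
  define s where "s = sum_list (map fst n_as)"
  have J: "jordan_matrix (na # n_as) = four_block_mat (jordan_block n a) (0\<^sub>m n s) (0\<^sub>m s n) (jordan_matrix n_as)"
    unfolding jordan_matrix_def[of "na # n_as"] by (simp add: Let_def na jordan_matrix_def[symmetric] s_def)
  have idx: "jordan_matrix (na # n_as) $$ (x, y) =
     (if x < n then if y < n then jordan_block n a $$ (x, y) else 0
      else if y < n then 0 else jordan_matrix n_as $$ (x - n, y - n))"
    if "x < n + s" "y < n + s" for x y
    unfolding J using that by (auto simp: s_def[symmetric])
  have b: "i < n + s" "j < n + s" using Cons.prems by (auto simp: na s_def)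
  show ?case
  proof (cases "i < n")
    case True
    then have "j < n" using Cons.prems(3) idx[OF b] by (auto split: if_splits)
    then show ?thesis using True Cons.prems(3,4) idx b by (auto split: if_splits)
  next
    case False
    then have j: "\<not> j < n" using Cons.prems(3) idx[OF b] by (auto split: if_splits)
    have "j - n = Suc (i - n) \<and> jordan_matrix n_as $$ (i - n, j - n) = 1 \<and>
        jordan_matrix n_as $$ (i - n, i - n) = jordan_matrix n_as $$ (j - n, j - n)"
      using Cons.prems(3,4) idx[OF b] False j b by (intro Cons.IH) (auto simp: s_def)
    then show ?thesis using False j idx b by auto
  qed
qed

lemma hermitian_mat_entry:
  assumes "hermitian_mat A" "A \<in> carrier_mat d d" "i < d" "j < d"
  shows "A $$ (i, j) = cnj (A $$ (j, i))"
proof -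
  have "mat_adjoint A $$ (i, j) = cnj (A $$ (j, i))"
    using assms(2-4) unfolding mat_adjoint_def by (simp add: mat_of_rows_def)
  then show ?thesis using assms(1) by (simp add: hermitian_mat_def)
qed

lemma hermitian_mat_self_adjoint:
  assumes "hermitian_mat A" "A \<in> carrier_mat d d" "u \<in> carrier_vec d" "v \<in> carrier_vec d"
  shows "(\<Sum>i<d. (A *\<^sub>v u) $ i * cnj (v $ i)) = (\<Sum>i<d. u $ i * cnj ((A *\<^sub>v v) $ i))"
proof -
  have "(\<Sum>i<d. (A *\<^sub>v u) $ i * cnj (v $ i)) = (\<Sum>i<d. \<Sum>j<d. A $$ (i, j) * u $ j * cnj (v $ i))"
    using assms by (intro sum.cong) (auto simp: scalar_prod_def lessThan_atLeast0 sum_distrib_right)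
  also have "\<dots> = (\<Sum>j<d. \<Sum>i<d. A $$ (i, j) * u $ j * cnj (v $ i))"
    by (rule sum.swap)
  also have "\<dots> = (\<Sum>j<d. \<Sum>i<d. u $ j * cnj (A $$ (j, i) * v $ i))"
  proof (intro sum.cong refl)
    fix j i assume "j \<in> {..<d}" "i \<in> {..<d}"
    then have "A $$ (i, j) = cnj (A $$ (j, i))" by (intro hermitian_mat_entry[OF assms(1,2)]) auto
    then show "A $$ (i, j) * u $ j * cnj (v $ i) = u $ j * cnj (A $$ (j, i) * v $ i)" by simp
  qed
  also have "\<dots> = (\<Sum>j<d. u $ j * cnj ((A *\<^sub>v v) $ j))"
    using assms by (intro sum.cong) (auto simp: scalar_prod_def lessThan_atLeast0 sum_distrib_left)
  finally show ?thesis .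
qed

text \<open>A generalised eigenvector chain \<open>A w = e w + v\<close>, \<open>A v = e v\<close> with \<open>e\<close> real gives
  \<open>\<langle>v, v\<rangle> = \<langle>(A - e) w, v\<rangle> = \<langle>w, (A - e) v\<rangle> = 0\<close>, so all Jordan blocks have size one.\<close>
lemma hermitian_no_eigenvector_chain:
  assumes A: "hermitian_mat A" "A \<in> carrier_mat d d" and "v \<in> carrier_vec d" "w \<in> carrier_vec d"
    and e: "e \<in> \<real>" and v: "A *\<^sub>v v = e \<cdot>\<^sub>v v" and w: "A *\<^sub>v w = e \<cdot>\<^sub>v w + v"
  shows "v = 0\<^sub>v d"
proof -
  have "(\<Sum>i<d. e * (w $ i * cnj (v $ i))) + (\<Sum>i<d. v $ i * cnj (v $ i)) =
      (\<Sum>i<d. (A *\<^sub>v w) $ i * cnj (v $ i))"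
    unfolding w sum.distrib[symmetric] using assms(3,4) by (intro sum.cong) (auto simp: algebra_simps)
  also have "\<dots> = (\<Sum>i<d. w $ i * cnj ((A *\<^sub>v v) $ i))"
    by (rule hermitian_mat_self_adjoint[OF A \<open>w \<in> _\<close> \<open>v \<in> _\<close>])
  also have "\<dots> = (\<Sum>i<d. e * (w $ i * cnj (v $ i)))"
    unfolding v using assms(3,4) e by (intro sum.cong) (auto simp: Reals_cnj_iff)
  finally have "(\<Sum>i<d. v $ i * cnj (v $ i)) = 0" by simp
  then have "of_real (\<Sum>i<d. (cmod (v $ i))\<^sup>2) = (0::complex)"
    by (simp add: complex_norm_square del: of_real_power)
  then have "(\<Sum>i<d. (cmod (v $ i))\<^sup>2) = 0" by (simp only: of_real_eq_0_iff)
  then have "\<forall>i<d. v $ i = 0" by (subst (asm) sum_nonneg_eq_0_iff) auto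
  then show ?thesis using assms(3) by auto
qed

text \<open>Start from a Jordan form. At the first column with an off-diagonal one, the column
  before it is already diagonal, so the matching columns of \<open>P\<close> form a chain with a
  real eigenvalue; the chain lemma then puts a zero column into an invertible matrix.\<close>

lemma hermitian_diagonalizable:
  assumes A: "hermitian_mat A" "A \<in> carrier_mat d d" and real: "\<And>e. eigenvalue A e \<Longrightarrow> e \<in> \<real>"
  shows "\<exists>D P Q. similar_mat_wit A D P Q \<and> D \<in> carrier_mat d d \<and> P \<in> carrier_mat d d \<and>
    Q \<in> carrier_mat d d \<and> (\<forall>i<d. \<forall>j<d. i \<noteq> j \<longrightarrow> D $$ (i, j) = 0) \<and>
    (\<forall>i<d. eigenvalue A (D $$ (i, i)))"
proof -
  obtain as where "char_poly A = (\<Prod>a\<leftarrow>as. [:- a, 1:])"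
    using char_poly_factorized[OF A(2)] by auto
  then obtain n_as where "jordan_nf A n_as" using jordan_nf_exists[OF A(2)] by blast
  then obtain P Q where wit: "similar_mat_wit A (jordan_matrix n_as) P Q"
    unfolding jordan_nf_def similar_mat_def by blast
  define D where "D = jordan_matrix n_as"
  note sim = similar_mat_witD2[OF A(2) wit, folded D_def]
  have D: "D \<in> carrier_mat d d" and P: "P \<in> carrier_mat d d" and Q: "Q \<in> carrier_mat d d"
    using sim by auto
  have s: "sum_list (map fst n_as) = d" using D unfolding D_def by auto
  have ut: "upper_triangular D"
    using jordan_matrix_upper_triangular[of _ n_as] unfolding D_def upper_triangular_def by auto
  have ev: "eigenvalue A (D $$ (i, i))" if "i < d" for i
  proof -
    have "char_poly A = char_poly D"
      using wit unfolding D_def by (intro char_poly_similar) (auto simp: similar_mat_def)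
    also have "\<dots> = (\<Prod>a\<leftarrow>diag_mat D. [:- a, 1:])" by (rule char_poly_upper_triangular[OF D ut])
    finally have "poly (char_poly A) (D $$ (i, i)) = (\<Prod>a\<leftarrow>diag_mat D. D $$ (i, i) - a)"
      by (simp add: poly_prod_list o_def)
    also have "\<dots> = 0"
      using that D by (auto simp: prod_list_zero_iff diag_mat_def)
    finally show ?thesis by (simp add: eigenvalue_root_char_poly[OF A(2)])
  qed
  have AP: "A * P = P * D"
  proof -
    have "A * P = P * D * Q * P" using sim by simp
    also have "\<dots> = P * D * (Q * P)" using D P Q by (intro assoc_mult_mat) auto
    also have "\<dots> = P * D" using sim D P by simp
    finally show ?thesis .
  qed
  have APcol: "A *\<^sub>v col P j = P *\<^sub>v col D j" if "j < d" for j
    using arg_cong[OF AP, of "\<lambda>X. col X j"] col_mult2[OF A(2) P that] col_mult2[OF P D that] by metis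
  have P_inj: "x = 0\<^sub>v d" if "P *\<^sub>v x = 0\<^sub>v d" "x \<in> carrier_vec d" for x
  proof -
    have "x = (Q * P) *\<^sub>v x" using sim that by simp
    also have "\<dots> = Q *\<^sub>v (P *\<^sub>v x)" using P Q that by (intro assoc_mult_mat_vec) auto
    also have "\<dots> = 0\<^sub>v d" using that Q by (intro eq_vecI) auto
    finally show ?thesis .
  qed
  have diag: "D $$ (i, j) = 0" if "i < d" "j < d" "i \<noteq> j" for i j
    using that
  proof (induction j arbitrary: i rule: less_induct)
    case (less j)
    show ?case
    proof (rule ccontr)
      assume "D $$ (i, j) \<noteq> 0"
      then have j: "j = Suc i" and one: "D $$ (i, j) = 1" and eq: "D $$ (i, i) = D $$ (j, j)"
        using jordan_matrix_off_diagonal[of i n_as j] less.prems s unfolding D_def by auto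
      define e where "e = D $$ (j, j)"
      have e: "e \<in> \<real>" using real ev less.prems by (simp add: e_def)
      have ci: "col D i = e \<cdot>\<^sub>v unit_vec d i"
        using less.IH[of i] less.prems j D eq by (intro eq_vecI) (auto simp: unit_vec_def e_def)
      have cj: "col D j = e \<cdot>\<^sub>v unit_vec d j + unit_vec d i"
      proof (rule eq_vecI)
        fix k assume "k < dim_vec (e \<cdot>\<^sub>v unit_vec d j + unit_vec d i)"
        then have k: "k < d" by simp
        have "D $$ (k, j) = 0" if "k \<noteq> i" "k \<noteq> j"
          using jordan_matrix_off_diagonal[of k n_as j] less.prems s k j that unfolding D_def by auto
        then show "col D j $ k = (e \<cdot>\<^sub>v unit_vec d j + unit_vec d i) $ k"
          using k less.prems D one by (auto simp: unit_vec_def e_def)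
      qed (use D in simp)
      have Pu: "P *\<^sub>v unit_vec d k = col P k" if "k < d" for k
        using P that by (intro eq_vecI) auto
      have "A *\<^sub>v col P i = e \<cdot>\<^sub>v col P i"
        unfolding APcol[OF less.prems(1)] ci
        using P less.prems by (subst mult_mat_vec[of _ d d]) (auto simp: Pu)
      moreover have "A *\<^sub>v col P j = e \<cdot>\<^sub>v col P j + col P i"
        unfolding APcol[OF less.prems(2)] cj
        using P less.prems by (subst mult_add_distrib_mat_vec[of _ d d]) (auto simp: Pu mult_mat_vec[of _ d d])
      ultimately have "col P i = 0\<^sub>v d"
        using P less.prems by (intro hermitian_no_eigenvector_chain[OF A _ _ e]) auto
      then have "unit_vec d i = (0\<^sub>v d :: complex vec)"
        using Pu[of i] P_inj[of "unit_vec d i"] less.prems by simp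
      then show False using less.prems by simp
    qed
  qed
  show ?thesis
    using wit[folded D_def] D P Q diag ev by blast
qed

section \<open>Powers and exponentials of a diagonalised matrix\<close>

lemma diagonal_mat_pow:
  fixes D :: "'a::comm_semiring_1 mat"
  assumes "D \<in> carrier_mat d d" "\<And>i j. i < d \<Longrightarrow> j < d \<Longrightarrow> i \<noteq> j \<Longrightarrow> D $$ (i, j) = 0"
  shows "D ^\<^sub>m k = mat d d (\<lambda>(i, j). if i = j then D $$ (i, i) ^ k else 0)"
proof (induction k)
  case 0
  then show ?case using assms(1) by (intro eq_matI) auto
next
  case (Suc k)
  show ?case
  proof (rule eq_matI)
    fix i j assume ij: "i < dim_row (mat d d (\<lambda>(i, j). if i = j then D $$ (i, i) ^ Suc k else 0))"
      "j < dim_col (mat d d (\<lambda>(i, j). if i = j then D $$ (i, i) ^ Suc k else 0))"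
    then have "(D ^\<^sub>m Suc k) $$ (i, j) = (\<Sum>l = 0..<d. (if i = l then D $$ (i, i) ^ k else 0) * D $$ (l, j))"
      using assms(1) by (simp add: Suc scalar_prod_def)
    also have "\<dots> = (\<Sum>l = 0..<d. if l = i then D $$ (i, i) ^ k * D $$ (i, j) else 0)"
      by (rule sum.cong) auto
    finally show "(D ^\<^sub>m Suc k) $$ (i, j) = mat d d (\<lambda>(i, j). if i = j then D $$ (i, i) ^ Suc k else 0) $$ (i, j)"
      using ij assms(2) by (auto simp: mult.commute)
  qed (use assms(1) in auto)
qed

lemma smult_mat_pow:
  fixes A :: "'a::comm_semiring_1 mat"
  assumes "A \<in> carrier_mat d d"
  shows "(c \<cdot>\<^sub>m A) ^\<^sub>m k = c ^ k \<cdot>\<^sub>m (A ^\<^sub>m k)"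
proof (induction k)
  case 0
  then show ?case using assms by (intro eq_matI) auto
next
  case (Suc k)
  have "c ^ k \<cdot>\<^sub>m (A ^\<^sub>m k) * (c \<cdot>\<^sub>m A) = c ^ k \<cdot>\<^sub>m (c \<cdot>\<^sub>m (A ^\<^sub>m k * A))"
    using assms by (subst mult_smult_assoc_mat[of _ d d _ d]) (auto simp: mult_smult_distrib[of _ d d _ d])
  also have "\<dots> = c ^ Suc k \<cdot>\<^sub>m (A ^\<^sub>m k * A)"
    by (intro eq_matI) (auto simp: mult_ac)
  finally show ?case by (simp add: Suc)
qed

text \<open>From \<open>A = P * D * Q\<close> the powers are P D^k Q, and the exponential series
  sums entrywise with coefficients free of c. For c = -i \<theta> every entry is thus an exponential
  sum with the negated eigenvalues as frequencies.\<close>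

lemma mat_exp_hermitian:
  assumes A: "hermitian_mat A" "A \<in> carrier_mat d d" and real: "\<And>e. eigenvalue A e \<Longrightarrow> e \<in> \<real>"
  obtains e R where "\<And>l. l < d \<Longrightarrow> eigenvalue A (e l)"
    "\<And>c i j. i < d \<Longrightarrow> j < d \<Longrightarrow> mat_exp (c \<cdot>\<^sub>m A) $$ (i, j) = (\<Sum>l<d. R l i j * exp (c * e l))"
proof -
  obtain D P Q where wit: "similar_mat_wit A D P Q" and D: "D \<in> carrier_mat d d" and P: "P \<in> carrier_mat d d"
    and Q: "Q \<in> carrier_mat d d" and diag: "\<And>i j. i < d \<Longrightarrow> j < d \<Longrightarrow> i \<noteq> j \<Longrightarrow> D $$ (i, j) = 0"
    and ev: "\<And>i. i < d \<Longrightarrow> eigenvalue A (D $$ (i, i))"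
    using hermitian_diagonalizable[OF assms] by blast
  define e where "e l = D $$ (l, l)" for l
  define R where "R l i j = P $$ (i, l) * Q $$ (l, j)" for l i j
  have pow: "(A ^\<^sub>m k) $$ (i, j) = (\<Sum>l<d. R l i j * e l ^ k)" if ij: "i < d" "j < d" for k i j
  proof -
    have Dk: "D ^\<^sub>m k = mat d d (\<lambda>(i, j). if i = j then D $$ (i, i) ^ k else 0)"
      by (rule diagonal_mat_pow[OF D diag])
    have "A ^\<^sub>m k = P * D ^\<^sub>m k * Q"
      using similar_mat_wit_pow[OF wit, of k] by (simp add: similar_mat_wit_def Let_def)
    then have "(A ^\<^sub>m k) $$ (i, j) = (\<Sum>l<d. (\<Sum>m<d. P $$ (i, m) * (D ^\<^sub>m k) $$ (m, l)) * Q $$ (l, j))"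
      using ij P Q D by (simp add: scalar_prod_def lessThan_atLeast0)
    also have "\<dots> = (\<Sum>l<d. R l i j * e l ^ k)"
    proof (rule sum.cong, simp)
      fix l assume l: "l \<in> {..<d}"
      have "(\<Sum>m<d. P $$ (i, m) * (D ^\<^sub>m k) $$ (m, l)) = (\<Sum>m<d. if m = l then P $$ (i, l) * e l ^ k else 0)"
        using l by (intro sum.cong) (auto simp: Dk e_def)
      also have "\<dots> = P $$ (i, l) * e l ^ k" using l by simp
      finally show "(\<Sum>m<d. P $$ (i, m) * (D ^\<^sub>m k) $$ (m, l)) * Q $$ (l, j) = R l i j * e l ^ k"
        by (simp add: R_def mult_ac)
    qed
    finally show ?thesis .
  qed
  have "mat_exp (c \<cdot>\<^sub>m A) $$ (i, j) = (\<Sum>l<d. R l i j * exp (c * e l))" if ij: "i < d" "j < d" for c i j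
  proof -
    have sums: "(\<lambda>k. \<Sum>l<d. R l i j * ((c * e l) ^ k /\<^sub>R fact k)) sums (\<Sum>l<d. R l i j * exp (c * e l))"
      by (intro sums_sum sums_mult exp_converges)
    have "((c \<cdot>\<^sub>m A) ^\<^sub>m k) $$ (i, j) / of_nat (fact k) = (\<Sum>l<d. R l i j * ((c * e l) ^ k /\<^sub>R fact k))" for k
    proof -
      have "A ^\<^sub>m k \<in> carrier_mat d d" using A(2) by simp
      from carrier_matD[OF this] have "((c \<cdot>\<^sub>m A) ^\<^sub>m k) $$ (i, j) = c ^ k * (\<Sum>l<d. R l i j * e l ^ k)"
        using pow[OF ij] ij by (simp add: smult_mat_pow[OF A(2)])
      then show ?thesis
        by (simp add: sum_distrib_left sum_divide_distrib power_mult_distrib scaleR_conv_of_real field_simps)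
    qed
    then show ?thesis
      using sums_unique[OF sums] ij A(2) by (simp add: mat_exp_def)
  qed
  with ev show ?thesis using that[of e R] by (simp add: e_def)
qed

section \<open>The loss as a trigonometric polynomial\<close>

text \<open>The sign comes from the exponent -i \<theta> H; coordinates from k on belong to layers
  not yet applied.\<close>

definition layer_freqs :: "(nat \<Rightarrow> complex mat) \<Rightarrow> nat \<Rightarrow> (nat \<Rightarrow> int) set" where
  "layer_freqs H k = {a. (\<forall>j\<ge>k. a j = 0) \<and> (\<forall>l<k. eigenvalue (H l) (- of_int (a l)))}"

definition freq_cube :: "nat \<Rightarrow> nat \<Rightarrow> (nat \<Rightarrow> int) set" where
  "freq_cube p D = {a. (\<forall>j\<ge>p. a j = 0) \<and> (\<forall>j<p. \<bar>a j\<bar> \<le> int D)}"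

lemma qnn_U_carrier:
  assumes "\<And>l. l < k \<Longrightarrow> H l \<in> carrier_mat d d"
  shows "qnn_U d H k \<theta> \<in> carrier_mat d d"
  using assms
proof (induction k)
  case (Suc k)
  then have "mat_exp ((- \<i> * complex_of_real (\<theta> k)) \<cdot>\<^sub>m H k) \<in> carrier_mat d d"
    using carrier_matD[OF Suc.prems[of k]] by (simp add: mat_exp_def)
  then show ?case using Suc by auto
qed simp

text \<open>A layer depends on its own angle only, so multiplying by it fills one new coordinate of
  the frequency vector; eigenvalues of different layers never add up in one coordinate.\<close>

lemma qnn_U_trig_poly:
  assumes "\<forall>l<k. H l \<in> carrier_mat d d" "\<forall>l<k. hermitian_mat (H l)"
    "\<forall>l<k. \<forall>E. eigenvalue (H l) E \<longrightarrow> E \<in> \<int>" "k \<le> p" "a < d" "b < d"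
  shows "(\<lambda>\<theta>. qnn_U d H k \<theta> $$ (a, b)) \<in> trig_poly p (layer_freqs H k)"
  using assms
proof (induction k arbitrary: a b)
  case 0
  have "(\<lambda>\<theta>. (if a = b then 1 else 0) * torus_char p (\<lambda>_. 0) \<theta>) \<in> trig_poly p (layer_freqs H 0)"
    by (rule trig_poly_scaled_char) (simp add: layer_freqs_def)
  then show ?case using 0 by simp
next
  case (Suc k)
  have Hk: "H k \<in> carrier_mat d d" "hermitian_mat (H k)" and int: "\<And>E. eigenvalue (H k) E \<Longrightarrow> E \<in> \<int>"
    using Suc.prems by auto
  have k: "k < p" using Suc.prems by simp
  have real: "E \<in> \<real>" if "eigenvalue (H k) E" for E
    using int[OF that] by (auto elim!: Ints_cases)
  obtain e R where e: "\<And>l. l < d \<Longrightarrow> eigenvalue (H k) (e l)" and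
    R: "\<And>c i j. i < d \<Longrightarrow> j < d \<Longrightarrow> mat_exp (c \<cdot>\<^sub>m H k) $$ (i, j) = (\<Sum>l<d. R l i j * exp (c * e l))"
    using mat_exp_hermitian[OF Hk(2,1) real] by blast
  define X where "X \<theta> = mat_exp ((- \<i> * complex_of_real (\<theta> k)) \<cdot>\<^sub>m H k)" for \<theta> :: "nat \<Rightarrow> real"
  define B where "B = {\<lambda>j. if j = k then n else 0 |n. eigenvalue (H k) (- of_int n)}"
  have X: "X \<theta> \<in> carrier_mat d d" for \<theta> using Hk(1) by (simp add: X_def mat_exp_def)
  have X_trig: "(\<lambda>\<theta>. X \<theta> $$ (i, j)) \<in> trig_poly p B" if ij: "i < d" "j < d" for i j
  proof -
    have "(\<lambda>\<theta>. \<Sum>l<d. R l i j * exp ((- \<i> * complex_of_real (\<theta> k)) * e l)) \<in> trig_poly p B"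
    proof (rule trig_poly_sum)
      fix l assume "l \<in> {..<d}"
      then have ev: "eigenvalue (H k) (e l)" using e by simp
      then obtain n where n: "e l = of_int n" using int by (auto elim: Ints_cases)
      have "exp ((- \<i> * complex_of_real (\<theta> k)) * e l) = torus_char p (\<lambda>j. if j = k then - n else 0) \<theta>" for \<theta>
        unfolding torus_char_unit[OF k] cis_conv_exp n by (simp add: mult_ac)
      moreover have "(\<lambda>j. if j = k then - n else 0) \<in> B" using ev n unfolding B_def by force
      ultimately show "(\<lambda>\<theta>. R l i j * exp ((- \<i> * complex_of_real (\<theta> k)) * e l)) \<in> trig_poly p B"
        by (simp only: trig_poly_scaled_char)
    qed
    then show ?thesis unfolding X_def R[OF ij] .
  qed
  have "(\<lambda>\<theta>. \<Sum>c<d. X \<theta> $$ (a, c) * qnn_U d H k \<theta> $$ (c, b)) \<in> trig_poly p (layer_freqs H (Suc k))"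
  proof (rule trig_poly_sum)
    fix c assume "c \<in> {..<d}"
    then have c: "c < d" by simp
    have U: "(\<lambda>\<theta>. qnn_U d H k \<theta> $$ (c, b)) \<in> trig_poly p (layer_freqs H k)"
      using Suc.prems c by (intro Suc.IH) (simp_all add: All_less_Suc)
    show "(\<lambda>\<theta>. X \<theta> $$ (a, c) * qnn_U d H k \<theta> $$ (c, b)) \<in> trig_poly p (layer_freqs H (Suc k))"
      by (rule trig_poly_mult[OF X_trig[OF \<open>a < d\<close> c] U]) (auto simp: B_def layer_freqs_def less_Suc_eq)
  qed
  moreover have "qnn_U d H (Suc k) \<theta> $$ (a, b) = (\<Sum>c<d. X \<theta> $$ (a, c) * qnn_U d H k \<theta> $$ (c, b))" for \<theta>
  proof -
    have U: "qnn_U d H k \<theta> \<in> carrier_mat d d" using Suc.prems by (intro qnn_U_carrier) auto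
    have "qnn_U d H (Suc k) \<theta> = X \<theta> * qnn_U d H k \<theta>" by (simp add: X_def)
    then show ?thesis
      using X[of \<theta>] U Suc.prems by (simp add: scalar_prod_def lessThan_atLeast0)
  qed
  ultimately show ?case by simp
qed

text \<open>Exposes products of an entry of \<open>U\<close> with a conjugate entry, so that only
  eigenvalue differences occur as frequencies.\<close>

lemma tr_conj_mult:
  assumes "U \<in> carrier_mat d d" "\<rho> \<in> carrier_mat d d" "M \<in> carrier_mat d d"
  shows "tr (U * \<rho> * mat_adjoint U * M) =
    (\<Sum>i<d. \<Sum>c<d. \<Sum>b<d. \<Sum>a<d. (\<rho> $$ (a, b) * M $$ (c, i)) * (U $$ (i, a) * cnj (U $$ (c, b))))"
proof -
  have adj: "mat_adjoint U \<in> carrier_mat d d" "\<And>b c. b < d \<Longrightarrow> c < d \<Longrightarrow> mat_adjoint U $$ (b, c) = cnj (U $$ (c, b))"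
    using assms(1) unfolding mat_adjoint_def by (auto simp: mat_of_rows_def)
  have "tr (U * \<rho> * mat_adjoint U * M) =
      (\<Sum>i<d. \<Sum>c<d. (\<Sum>b<d. (\<Sum>a<d. U $$ (i, a) * \<rho> $$ (a, b)) * cnj (U $$ (c, b))) * M $$ (c, i))"
    using assms adj by (simp add: tr_def scalar_prod_def lessThan_atLeast0 del: assoc_mult_mat)
  also have "\<dots> = (\<Sum>i<d. \<Sum>c<d. \<Sum>b<d. \<Sum>a<d. (\<rho> $$ (a, b) * M $$ (c, i)) * (U $$ (i, a) * cnj (U $$ (c, b))))"
    by (simp only: sum_distrib_right) (simp only: mult_ac)
  finally show ?thesis .
qed

lemma freq_cube_add:
  assumes "a \<in> freq_cube p D" "b \<in> freq_cube p D'"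
  shows "(\<lambda>j. a j + b j) \<in> freq_cube p (D + D')"
proof -
  have "\<bar>a j + b j\<bar> \<le> int D + int D'" if "j < p" for j
    using assms that abs_triangle_ineq[of "a j" "b j"] by (force simp: freq_cube_def)
  then show ?thesis using assms by (simp add: freq_cube_def)
qed

lemma trig_poly_freq_cube_0_const:
  assumes "f \<in> trig_poly p (freq_cube p 0)"
  shows "f \<theta> = f \<theta>'"
  using assms
proof induction
  case (add_char f a c)
  then have "a = (\<lambda>_. 0)" by (auto simp: freq_cube_def not_le[symmetric])
  then show ?case using add_char.IH by simp
qed simp

text \<open>Eigenvalue gaps bound the frequencies of the expectation values by \<Delta>, integrality
  sharpens this to the floor, and the square in the loss doubles it.\<close>

lemma qnn_loss_trig_poly:
  assumes H_dim: "\<forall>l<p. H l \<in> carrier_mat d d"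
    and H_herm: "\<forall>l<p. hermitian_mat (H l)"
    and H_int: "\<forall>l<p. \<forall>E. eigenvalue (H l) E \<longrightarrow> E \<in> \<int>"
    and H_gap: "\<forall>l<p. \<forall>E E'. eigenvalue (H l) E \<and> eigenvalue (H l) E' \<longrightarrow> cmod (E - E') \<le> \<Delta>"
    and M_dim: "M \<in> carrier_mat d d"
    and data: "\<forall>i<m. \<rho> i \<in> carrier_mat d d"
  shows "(\<lambda>\<theta>. complex_of_real (qnn_loss d H M p m \<rho> y \<theta>)) \<in> trig_poly p (freq_cube p (2 * nat \<lfloor>\<Delta>\<rfloor>))"
proof -
  define D where "D = nat \<lfloor>\<Delta>\<rfloor>"
  define G where "G i \<theta> = tr (qnn_U d H p \<theta> * \<rho> i * mat_adjoint (qnn_U d H p \<theta>) * M)" for i \<theta>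
  have diff: "(\<lambda>j. a j + b j) \<in> freq_cube p D"
    if a: "a \<in> layer_freqs H p" and b: "b \<in> (\<lambda>a j. - a j) ` layer_freqs H p" for a b
  proof -
    obtain b' where b': "b' \<in> layer_freqs H p" "b = (\<lambda>j. - b' j)" using b by blast
    have "\<bar>a j - b' j\<bar> \<le> int D" if "j < p" for j
    proof -
      have "eigenvalue (H j) (- of_int (a j))" "eigenvalue (H j) (- of_int (b' j))"
        using a b'(1) that by (auto simp: layer_freqs_def)
      then have "cmod (- of_int (a j) - - of_int (b' j)) \<le> \<Delta>" using H_gap that by blast
      moreover have "- of_int (a j) - - of_int (b' j) = complex_of_int (b' j - a j)" by simp
      ultimately have "\<bar>of_int (b' j - a j)\<bar> \<le> \<Delta>" by (simp only: norm_of_int)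
      then have "of_int \<bar>a j - b' j\<bar> \<le> \<Delta>" by simp
      then have "\<bar>a j - b' j\<bar> \<le> \<lfloor>\<Delta>\<rfloor>" by (simp only: le_floor_iff)
      also have "\<lfloor>\<Delta>\<rfloor> \<le> int D" unfolding D_def int_nat_eq by (split if_split) linarith
      finally show ?thesis .
    qed
    then show ?thesis using a b' by (simp add: freq_cube_def layer_freqs_def)
  qed
  have G: "G i \<in> trig_poly p (freq_cube p D)" if i: "i < m" for i
  proof -
    have U: "(\<lambda>\<theta>. qnn_U d H p \<theta> $$ (a, b)) \<in> trig_poly p (layer_freqs H p)" if "a < d" "b < d" for a b
      using H_dim H_herm H_int that by (intro qnn_U_trig_poly) auto
    have U': "(\<lambda>\<theta>. cnj (qnn_U d H p \<theta> $$ (a, b))) \<in> trig_poly p ((\<lambda>a j. - a j) ` layer_freqs H p)"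
      if "a < d" "b < d" for a b
      by (rule trig_poly_cnj[OF U[OF that]]) blast
    have "qnn_U d H p \<theta> \<in> carrier_mat d d" for \<theta> using H_dim by (intro qnn_U_carrier) auto
    then have "G i = (\<lambda>\<theta>. \<Sum>j<d. \<Sum>c<d. \<Sum>b<d. \<Sum>a<d. (\<rho> i $$ (a, b) * M $$ (c, j)) *
        (qnn_U d H p \<theta> $$ (j, a) * cnj (qnn_U d H p \<theta> $$ (c, b))))"
      unfolding G_def using tr_conj_mult[OF _ data[rule_format, OF i] M_dim] by blast
    also have "\<dots> \<in> trig_poly p (freq_cube p D)"
      by (intro trig_poly_sum trig_poly_scale trig_poly_mult[OF U U' diff]) auto
    finally show ?thesis .
  qed
  \<comment> \<open>The frequency cube is symmetric under negation, so the real part, as half of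
    \<open>G + cnj G\<close>, adds no frequencies.\<close>
  have Re: "(\<lambda>\<theta>. complex_of_real (Re (G i \<theta>) - y i)) \<in> trig_poly p (freq_cube p D)" if i: "i < m" for i
  proof -
    have cnj: "(\<lambda>\<theta>. cnj (G i \<theta>)) \<in> trig_poly p (freq_cube p D)"
      by (rule trig_poly_cnj[OF G[OF i]]) (simp add: freq_cube_def)
    have const: "(\<lambda>\<theta>. - of_real (y i) * torus_char p (\<lambda>_. 0) \<theta>) \<in> trig_poly p (freq_cube p D)"
      by (rule trig_poly_scaled_char) (simp add: freq_cube_def)
    have "(\<lambda>\<theta>. complex_of_real (Re (G i \<theta>) - y i)) =
        (\<lambda>\<theta>. (1 / 2) * (G i \<theta> + cnj (G i \<theta>)) + - of_real (y i) * torus_char p (\<lambda>_. 0) \<theta>)"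
      by (rule ext) (simp add: complex_add_cnj)
    then show ?thesis
      using trig_poly_add[OF trig_poly_scale[OF trig_poly_add[OF G[OF i] cnj], of "1 / 2"] const] by (simp only:)
  qed
  have "(\<lambda>\<theta>. complex_of_real (Re (G i \<theta>) - y i) * complex_of_real (Re (G i \<theta>) - y i))
      \<in> trig_poly p (freq_cube p (D + D))" if "i < m" for i
    by (rule trig_poly_mult[OF Re[OF that] Re[OF that] freq_cube_add])
  then have "(\<lambda>\<theta>. complex_of_real (1 / real m) *
      (\<Sum>i<m. complex_of_real (Re (G i \<theta>) - y i) * complex_of_real (Re (G i \<theta>) - y i))) \<in> trig_poly p (freq_cube p (D + D))"
    by (intro trig_poly_scale trig_poly_sum) auto
  moreover have "complex_of_real (qnn_loss d H M p m \<rho> y \<theta>) = complex_of_real (1 / real m) *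
      (\<Sum>i<m. complex_of_real (Re (G i \<theta>) - y i) * complex_of_real (Re (G i \<theta>) - y i))" for \<theta>
    by (simp add: qnn_loss_def G_def power2_eq_square)
  ultimately show ?thesis by (simp add: D_def mult_2)
qed

text \<open>The passage from degree per coordinate to total degree is the source of the factor p
  inside the final bound.\<close>

lemma freq_cube_subset_l1_ball: "freq_cube p D \<subseteq> l1_ball p (int (D * p))"
proof
  fix a assume a: "a \<in> freq_cube p D"
  have "(\<Sum>j<p. \<bar>a j\<bar>) \<le> (\<Sum>j<p. int D)" using a by (intro sum_mono) (auto simp: freq_cube_def)
  then show "a \<in> l1_ball p (int (D * p))" using a by (simp add: freq_cube_def l1_ball_def mult.commute)
qed

text \<open>Rules out a constant loss, for which every point of the box would be critical.\<close>

lemma infinite_period_box: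
  assumes "0 < p"
  shows "infinite (period_box p)"
proof
  assume "finite (period_box p)"
  moreover have "(\<lambda>t. (\<lambda>_. 0)(0 := t)) ` {0<..<1} \<subseteq> period_box p"
    using assms pi_gt3 by (auto simp: period_box_def param_space_def)
  moreover have "inj_on (\<lambda>t. (\<lambda>_. 0)(0 := t)) {0<..<1::real}"
    by (auto simp: inj_on_def fun_eq_iff)
  ultimately have "finite {0<..<1::real}" using finite_imageD finite_subset by blast
  then show False using infinite_Ioo[of 0 "1::real"] by simp
qed

theorem theorem4:
  fixes d p m :: nat and H :: "nat \<Rightarrow> complex mat" and M :: "complex mat"
    and \<rho> :: "nat \<Rightarrow> complex mat" and y :: "nat \<Rightarrow> real" and \<Delta> :: real
  assumes H_dim: "\<forall>l<p. H l \<in> carrier_mat d d"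
    and H_herm: "\<forall>l<p. hermitian_mat (H l)"
    and H_int: "\<forall>l<p. \<forall>E. eigenvalue (H l) E \<longrightarrow> E \<in> \<int>"
    and H_gap: "\<forall>l<p. \<forall>E E'. eigenvalue (H l) E \<and> eigenvalue (H l) E' \<longrightarrow> cmod (E - E') \<le> \<Delta>"
    and M_dim: "M \<in> carrier_mat d d"
    and M_herm: "hermitian_mat M"
    and data: "\<forall>i<m. density_mat d (\<rho> i)"
    and fin_crit: "finite {\<theta> \<in> period_box p. critical_point p (qnn_loss d H M p m \<rho> y) \<theta>}"
  shows "finite {\<theta> \<in> period_box p. local_min p (qnn_loss d H M p m \<rho> y) \<theta>}
    \<and> real (card {\<theta> \<in> period_box p. local_min p (qnn_loss d H M p m \<rho> y) \<theta>})
        \<le> (4 * \<Delta> * real p) ^ p"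
proof -
  define L where "L = qnn_loss d H M p m \<rho> y"
  define D where "D = nat \<lfloor>\<Delta>\<rfloor>"
  have L: "(\<lambda>\<theta>. complex_of_real (L \<theta>)) \<in> trig_poly p (freq_cube p (2 * D))"
    unfolding L_def D_def using data by (intro qnn_loss_trig_poly assms) (simp add: density_mat_def)
  \<comment> \<open>The counting argument needs a positive perturbing frequency. For
    \<open>p = 0\<close> the box is one point and the bound is an empty power; for
    \<open>D = 0\<close> the loss is constant, against the finiteness of the critical
    points.\<close>
  consider "p = 0" | "0 < p" "D = 0" | "0 < p" "0 < D" by blast
  then have "finite {\<theta> \<in> period_box p. local_min p L \<theta>} \<and>
      real (card {\<theta> \<in> period_box p. local_min p L \<theta>}) \<le> (4 * \<Delta> * real p) ^ p"
  proof cases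
    case 1
    then have sub: "{\<theta> \<in> period_box p. local_min p L \<theta>} \<subseteq> {\<lambda>_. 0}"
      by (auto simp: period_box_def param_space_def)
    have "finite {\<theta> \<in> period_box p. local_min p L \<theta>}" by (rule finite_subset[OF sub]) simp
    moreover have "card {\<theta> \<in> period_box p. local_min p L \<theta>} \<le> 1" using card_mono[OF _ sub] by simp
    ultimately show ?thesis using 1 by simp
  next
    case 2
    define c where "c = L (\<lambda>_. 0)"
    have "L \<theta> = c" for \<theta>
      unfolding c_def
      using trig_poly_freq_cube_0_const[of "\<lambda>\<theta>. complex_of_real (L \<theta>)" p \<theta> "\<lambda>_. 0"] L 2 by simp
    then have "L = (\<lambda>_. c)" by (rule ext)
    then have "critical_point p L \<theta>" if "\<theta> \<in> param_space p" for \<theta>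
      using that by (simp add: critical_point_def)
    then have "period_box p \<subseteq> {\<theta> \<in> period_box p. critical_point p L \<theta>}" by (auto simp: period_box_def)
    then show ?thesis using infinite_period_box[OF \<open>0 < p\<close>] fin_crit finite_subset unfolding L_def by blast
  next
    case 3
    define n where "n = 2 * D * p"
    have n: "0 < n" using 3 by (simp add: n_def)
    have "(\<lambda>\<theta>. complex_of_real (L \<theta>)) \<in> trig_poly p (l1_ball p (int n))"
      unfolding n_def by (rule trig_poly_mono[OF L freq_cube_subset_l1_ball])
    from trig_poly_local_min_count[OF this n] fin_crit
    have fin: "finite {\<theta> \<in> period_box p. local_min p L \<theta>}"
      and card: "card {\<theta> \<in> period_box p. local_min p L \<theta>} \<le> (2 * n) ^ p"
      unfolding L_def by blast+
    have "real (card {\<theta> \<in> period_box p. local_min p L \<theta>}) \<le> real ((2 * n) ^ p)"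
      using card by (simp only: of_nat_le_iff)
    also have "\<dots> = (4 * real D * real p) ^ p" by (simp add: n_def mult_ac)
    also have "\<dots> \<le> (4 * \<Delta> * real p) ^ p"
    proof (intro power_mono mult_right_mono mult_left_mono)
      \<comment> \<open>A positive \<open>D\<close> is the floor itself, with no truncation at
        zero.\<close>
      show "real D \<le> \<Delta>" using \<open>0 < D\<close> unfolding D_def by linarith
    qed auto
    finally show ?thesis using fin by blast
  qed
  then show ?thesis unfolding L_def .
qed

end
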